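(* Let $T$ be a locally finite tree with a fixed root at infinity, in which every vertex has at least two successors, and let $m$ be a flow measure on $T$ with $C_m:=\sup_{x\in T}\frac{m(p(x))}{m(x)}<\infty$; put $D_m:=\sup_{x\in T}\frac{m(x)}{m(p(x))}$. Let $k_a,k_b,k_d>0$ and $k_c>1$, and let $\sigma_i(n)=k_i^n$ for $n\in\mathbb Z$, $i\in\{a,b,c,d\}$. Let $p\in(1,\infty)$ and $1/p+1/p'=1$. Assume that 1) there is a constant $c_0>0$ such that $m(x)\le c_0\left(\frac{k_c}{k_bk_a}\right)^{\ell(x)}$ for every $x\in T$; 2) $\displaystyle \frac{C_mD_m^{2-1/p'}k_b^{1/p'}}{k_a^{1/p}k_c^{1/p'}}<k_d^{1/p}<\frac{k_b^{1/p'}k_c^{1/p}}{C_m^{2-1/p'}D_mk_a^{1/p}}$. Then $\mathcal V_{a,b,c}$ is bounded on $L^p(m\cdot\sigma_d)$.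
   Context: Tree notation. $T$ is an infinite locally finite tree with graph distance $d$ and a fixed reference vertex $o$. The boundary $\partial T$ is the set of equivalence classes of infinite geodesics starting at $o$ (two being equivalent if they eventually coincide). Fix $\omega\in\partial T$ (the root at infinity); let $[o,\omega)=\{x_n\}_{n\ge0}$ be the geodesic ray from $o$ (with $x_0=o$) representing $\omega$. The level is $\ell(x)=\lim_{n\to\infty}(n-d(x,x_n))$. For each vertex $x$, $p(x)$ is the unique neighbour with $\ell(p(x))=\ell(x)+1$, and $s(x)$ is the set of the other neighbours (successors). $p^0(x)=x$, $p^n(x)=p(p^{n-1}(x))$; $s_0(x)=\{x\}$, $s_n(x)=\bigcup_{y\in s_{n-1}(x)}s(y)$. $T_x=\bigcup_{n\ge0}s_n(x)$ and $\dot T_x=T_x\setminus\{x\}$. A flow measure is a function $m:T\to(0,\infty)$ with $m(x)=\sum_{y\in s(x)}m(y)$ for all $x$. Each $\sigma_i$ is also viewed as a function on $T$ via $\sigma_i(x)=\sigma_i(\ell(x))$, and $m\cdot\sigma_i$ is the measure on $T$ giving mass $m(x)\sigma_i(x)$ to the vertex $x$. For $n\in\mathbb Z$, $x\in T$, set $S_{n,x}(\sigma_c)=\sum_{k=0}^\infty\sigma_c(\ell(x)+n-k)$. For $v,z,x\in T$ set $\Psi(v,z,x)=0$ if $\{x,z\}\not\subset\dot T_v$; $\Psi(v,z,x)=\frac1{m(y)}-\frac1{m(v)}$ if $\{x,z\}\subset T_y$ for some $y\in s(v)$; and $\Psi(v,z,x)=-\frac1{m(v)}$ otherwise. The Bergman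 kernel of $L^2(m\cdot\sigma_c)$ is $$K_c(x,y)=\sum_{n=0}^\infty\frac{\Psi(p^{n+1}(x),p^n(x),y)}{S_{n,x}(\sigma_c)},\qquad x,y\in T.$$ The operator $\mathcal V_{a,b,c}$ is $$\mathcal V_{a,b,c}f(x)=m(x)\sigma_a(x)\sum_{y\in T}|K_c(x,y)|f(y)m(y)\sigma_b(y).$$ It is bounded on $L^p(m\cdot\sigma_d)$ if there is a constant $C$ such that for every $f\in L^p(m\cdot\sigma_d)$ the series converges absolutely for every $x$ and $\|\mathcal V_{a,b,c}f\|_{L^p(m\cdot\sigma_d)}\le C\|f\|_{L^p(m\cdot\sigma_d)}$. *)

theory Defs
  imports "HOL-Analysis.Analysis"
begin

section \<open>Trees, boundary, level\<close>

text \<open>A graph is given by its adjacency relation; the vertex set is the whole type.\<close>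

definition is_cycle :: "('v \<Rightarrow> 'v \<Rightarrow> bool) \<Rightarrow> 'v list \<Rightarrow> bool" where
  "is_cycle adj xs \<longleftrightarrow>
     length xs \<ge> 3 \<and> distinct xs \<and> successively adj xs \<and> adj (last xs) (hd xs)"

definition tree :: "('v \<Rightarrow> 'v \<Rightarrow> bool) \<Rightarrow> bool" where
  "tree adj \<longleftrightarrow>
     symp adj \<and> irreflp adj \<and> (\<forall>x y. adj\<^sup>*\<^sup>* x y) \<and> (\<nexists>xs. is_cycle adj xs)"

definition locally_finite :: "('v \<Rightarrow> 'v \<Rightarrow> bool) \<Rightarrow> bool" where
  "locally_finite adj \<longleftrightarrow> (\<forall>x. finite {y. adj x y})"

definition gdist :: "('v \<Rightarrow> 'v \<Rightarrow> bool) \<Rightarrow> 'v \<Rightarrow> 'v \<Rightarrow> nat" where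
  "gdist adj x y = (LEAST n. (adj ^^ n) x y)"

definition geodesic_rays :: "('v \<Rightarrow> 'v \<Rightarrow> bool) \<Rightarrow> 'v \<Rightarrow> (nat \<Rightarrow> 'v) set" where
  "geodesic_rays adj v0 = {r. r 0 = v0 \<and> (\<forall>i j. i \<le> j \<longrightarrow> gdist adj (r i) (r j) = j - i)}"

definition ray_equiv :: "('v \<Rightarrow> 'v \<Rightarrow> bool) \<Rightarrow> 'v \<Rightarrow> ((nat \<Rightarrow> 'v) \<times> (nat \<Rightarrow> 'v)) set" where
  "ray_equiv adj v0 = {(r, r'). r \<in> geodesic_rays adj v0 \<and> r' \<in> geodesic_rays adj v0 \<and>
                                eventually (\<lambda>n. r n = r' n) sequentially}"

definition boundary :: "('v \<Rightarrow> 'v \<Rightarrow> bool) \<Rightarrow> 'v \<Rightarrow> (nat \<Rightarrow> 'v) set set" where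
  "boundary adj v0 = geodesic_rays adj v0 // ray_equiv adj v0"

text \<open>In a tree, geodesic rays from a common origin that eventually coincide are equal, so a
  boundary point is a singleton class and \<open>ray_to \<omega>\<close> is its only element.\<close>

definition ray_to :: "(nat \<Rightarrow> 'v) set \<Rightarrow> nat \<Rightarrow> 'v" where
  "ray_to \<omega> = (THE r. r \<in> \<omega>)"

text \<open>The limit is taken in the discrete space of integers: in a tree the sequence is eventually
  constant.\<close>

definition level :: "('v \<Rightarrow> 'v \<Rightarrow> bool) \<Rightarrow> (nat \<Rightarrow> 'v) set \<Rightarrow> 'v \<Rightarrow> int" where
  "level adj \<omega> x = lim (\<lambda>n. int n - int (gdist adj x (ray_to \<omega> n)))"

definition pred :: "('v \<Rightarrow> 'v \<Rightarrow> bool) \<Rightarrow> (nat \<Rightarrow> 'v) set \<Rightarrow> 'v \<Rightarrow> 'v" where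
  "pred adj \<omega> x = (THE y. adj x y \<and> level adj \<omega> y = level adj \<omega> x + 1)"

definition succs :: "('v \<Rightarrow> 'v \<Rightarrow> bool) \<Rightarrow> (nat \<Rightarrow> 'v) set \<Rightarrow> 'v \<Rightarrow> 'v set" where
  "succs adj \<omega> x = {y. adj x y \<and> y \<noteq> pred adj \<omega> x}"

primrec succs_n :: "('v \<Rightarrow> 'v \<Rightarrow> bool) \<Rightarrow> (nat \<Rightarrow> 'v) set \<Rightarrow> nat \<Rightarrow> 'v \<Rightarrow> 'v set" where
  "succs_n adj \<omega> 0 x = {x}"
| "succs_n adj \<omega> (Suc n) x = (\<Union>y\<in>succs_n adj \<omega> n x. succs adj \<omega> y)"

definition sector :: "('v \<Rightarrow> 'v \<Rightarrow> bool) \<Rightarrow> (nat \<Rightarrow> 'v) set \<Rightarrow> 'v \<Rightarrow> 'v set" where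
  "sector adj \<omega> x = (\<Union>n. succs_n adj \<omega> n x)"

definition punctured_sector :: "('v \<Rightarrow> 'v \<Rightarrow> bool) \<Rightarrow> (nat \<Rightarrow> 'v) set \<Rightarrow> 'v \<Rightarrow> 'v set" where
  "punctured_sector adj \<omega> x = sector adj \<omega> x - {x}"

definition flow_measure ::
  "('v \<Rightarrow> 'v \<Rightarrow> bool) \<Rightarrow> (nat \<Rightarrow> 'v) set \<Rightarrow> ('v \<Rightarrow> real) \<Rightarrow> bool" where
  "flow_measure adj \<omega> m \<longleftrightarrow> (\<forall>x. m x > 0 \<and> m x = (\<Sum>y\<in>succs adj \<omega> x. m y))"

definition weighted_measure ::
  "('v \<Rightarrow> 'v \<Rightarrow> bool) \<Rightarrow> (nat \<Rightarrow> 'v) set \<Rightarrow> ('v \<Rightarrow> real) \<Rightarrow> (int \<Rightarrow> real) \<Rightarrow> 'v measure" where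
  "weighted_measure adj \<omega> m \<sigma> = point_measure UNIV (\<lambda>x. ennreal (m x * \<sigma> (level adj \<omega> x)))"

section \<open>The Bergman kernel and the integral operator\<close>

definition S_sum ::
  "('v \<Rightarrow> 'v \<Rightarrow> bool) \<Rightarrow> (nat \<Rightarrow> 'v) set \<Rightarrow> (int \<Rightarrow> real) \<Rightarrow> int \<Rightarrow> 'v \<Rightarrow> real" where
  "S_sum adj \<omega> \<sigma> n x = (\<Sum>k. \<sigma> (level adj \<omega> x + n - int k))"

text \<open>Sectors of distinct successors of \<open>v\<close> are disjoint, so the description below is unique.\<close>

definition Psi ::
  "('v \<Rightarrow> 'v \<Rightarrow> bool) \<Rightarrow> (nat \<Rightarrow> 'v) set \<Rightarrow> ('v \<Rightarrow> real) \<Rightarrow> 'v \<Rightarrow> 'v \<Rightarrow> 'v \<Rightarrow> real" where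
  "Psi adj \<omega> m v z x =
     (if \<not> {x, z} \<subseteq> punctured_sector adj \<omega> v then 0
      else if \<exists>y\<in>succs adj \<omega> v. {x, z} \<subseteq> sector adj \<omega> y
      then 1 / m (THE y. y \<in> succs adj \<omega> v \<and> {x, z} \<subseteq> sector adj \<omega> y) - 1 / m v
      else - (1 / m v))"

definition bergman_kernel ::
  "('v \<Rightarrow> 'v \<Rightarrow> bool) \<Rightarrow> (nat \<Rightarrow> 'v) set \<Rightarrow> ('v \<Rightarrow> real) \<Rightarrow> (int \<Rightarrow> real) \<Rightarrow> 'v \<Rightarrow> 'v \<Rightarrow> real" where
  "bergman_kernel adj \<omega> m \<sigma> x y =
     (\<Sum>n. Psi adj \<omega> m ((pred adj \<omega> ^^ Suc n) x) ((pred adj \<omega> ^^ n) x) y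
            / S_sum adj \<omega> \<sigma> (int n) x)"

definition V_summand ::
  "('v \<Rightarrow> 'v \<Rightarrow> bool) \<Rightarrow> (nat \<Rightarrow> 'v) set \<Rightarrow> ('v \<Rightarrow> real) \<Rightarrow> (int \<Rightarrow> real) \<Rightarrow> (int \<Rightarrow> real) \<Rightarrow>
   ('v \<Rightarrow> complex) \<Rightarrow> 'v \<Rightarrow> 'v \<Rightarrow> complex" where
  "V_summand adj \<omega> m \<sigma>b \<sigma>c f x y =
     of_real \<bar>bergman_kernel adj \<omega> m \<sigma>c x y\<bar> * f y * of_real (m y * \<sigma>b (level adj \<omega> y))"

definition V_op ::
  "('v \<Rightarrow> 'v \<Rightarrow> bool) \<Rightarrow> (nat \<Rightarrow> 'v) set \<Rightarrow> ('v \<Rightarrow> real) \<Rightarrow>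
   (int \<Rightarrow> real) \<Rightarrow> (int \<Rightarrow> real) \<Rightarrow> (int \<Rightarrow> real) \<Rightarrow> ('v \<Rightarrow> complex) \<Rightarrow> 'v \<Rightarrow> complex" where
  "V_op adj \<omega> m \<sigma>a \<sigma>b \<sigma>c f x =
     of_real (m x * \<sigma>a (level adj \<omega> x)) * (\<Sum>\<^sub>\<infinity>y. V_summand adj \<omega> m \<sigma>b \<sigma>c f x y)"

section \<open>Boundedness on weighted Lebesgue spaces\<close>

definition Lp_space :: "real \<Rightarrow> 'v measure \<Rightarrow> ('v \<Rightarrow> complex) set" where
  "Lp_space p M = {f \<in> borel_measurable M. integrable M (\<lambda>x. norm (f x) powr p)}"

definition Lp_norm :: "real \<Rightarrow> 'v measure \<Rightarrow> ('v \<Rightarrow> complex) \<Rightarrow> real" where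
  "Lp_norm p M f = (LINT x|M. norm (f x) powr p) powr (1 / p)"

text \<open>Since \<^const>\<open>Lp_norm\<close> is a junk value outside \<^const>\<open>Lp_space\<close>, finiteness of the norm of the
  image is required explicitly.\<close>

definition V_bounded ::
  "('v \<Rightarrow> 'v \<Rightarrow> bool) \<Rightarrow> (nat \<Rightarrow> 'v) set \<Rightarrow> ('v \<Rightarrow> real) \<Rightarrow>
   (int \<Rightarrow> real) \<Rightarrow> (int \<Rightarrow> real) \<Rightarrow> (int \<Rightarrow> real) \<Rightarrow> real \<Rightarrow> (int \<Rightarrow> real) \<Rightarrow> bool" where
  "V_bounded adj \<omega> m \<sigma>a \<sigma>b \<sigma>c p \<sigma>d \<longleftrightarrow>
     (let M = weighted_measure adj \<omega> m \<sigma>d in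
      \<exists>C. \<forall>f \<in> Lp_space p M.
        (\<forall>x. (\<lambda>y. norm (V_summand adj \<omega> m \<sigma>b \<sigma>c f x y)) summable_on UNIV) \<and>
        V_op adj \<omega> m \<sigma>a \<sigma>b \<sigma>c f \<in> Lp_space p M \<and>
        Lp_norm p M (V_op adj \<omega> m \<sigma>a \<sigma>b \<sigma>c f) \<le> C * Lp_norm p M f)"

end

theory Submission
  imports Defs
begin

text \<open>
  Dropping all cancellation, the Bergman kernel is dominated, up to a constant, by the kernel
  \<open>G(x, y) = \<Sum>v. kc\<^bsup>-\<l>(v)\<^esup> / m(v)\<close>, where \<open>v\<close> runs through the common ancestors of \<open>x\<close> and \<open>y\<close>
  (\<open>abs_bergman_kernel_le\<close>): the \<open>n\<close>-th term of its series notices \<open>y\<close> only through the sectors of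
  \<open>p\<^sup>n(x)\<close> and \<open>p\<^bsup>n+1\<^esup>(x)\<close>, and its denominator is a geometric series comparable to
  \<open>kc\<^bsup>\<l>(x)+n\<^esup>\<close>. Hence it is enough to bound a positive operator, by Schur's test (\<open>Schur_test\<close>) with
  a test function \<open>q\<^bsup>\<l>\<^esup>\<close> that depends on the level alone.

  Both integrals in Schur's test are of the form \<open>\<Sum>y. G(x, y) g(y)\<close>, with \<open>g = m s\<^bsup>\<l>\<^esup>\<close> for
  \<open>s = kb q\<close> and with \<open>g = m\<^sup>2 t\<^bsup>\<l>\<^esup>\<close> for \<open>t = ka kd q\<^bsup>p-1\<^esup>\<close>. Grouping \<open>y\<close> by its common ancestor with
  \<open>x\<close> and by its depth below this ancestor gives a double geometric series
  (\<open>nn_integral_ancestor_kernel_le\<close>). As the flow property preserves the total mass of a generation,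
  the series converge for \<open>1 < s < kc\<close> and for \<open>Dm < t < kc / Cm\<close>. The outcome is the test function
  times \<open>m (ka kb / kc)\<^bsup>\<l>\<^esup>\<close>, and this factor is bounded by the first assumption of the theorem. The
  second assumption provides a \<open>q\<close> for which \<open>s\<close> and \<open>t\<close> are in these ranges (\<open>ex_Schur_weight\<close>); here
  \<open>Cm Dm \<ge> 1\<close> is used.

  On the side of the tree, the level must be shown to exist and to make \<open>pred\<close> a parent map: the
  level changes by one along each edge, and a single edge leads upwards from each vertex. This comes
  from the fact that in a tree all but one of the neighbours of a vertex are strictly farther from a
  given target (\<open>neighbour_towards_unique\<close>).
\<close>

section \<open>Graph distance in trees\<close>

lemma gdist_le: "(adj ^^ n) x y \<Longrightarrow> gdist adj x y \<le> n"
  unfolding gdist_def by (rule Least_le)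

lemma tree_walk_gdist:
  assumes "tree adj"
  shows "(adj ^^ gdist adj x y) x y"
proof -
  have "adj\<^sup>*\<^sup>* x y"
    using assms by (simp add: tree_def)
  then have "\<exists>n. (adj ^^ n) x y"
    by (rule rtranclp_imp_relpowp)
  then show ?thesis
    unfolding gdist_def by (rule LeastI_ex)
qed

lemma gdist_eq_0_iff:
  assumes "tree adj"
  shows "gdist adj x y = 0 \<longleftrightarrow> x = y"
proof
  assume "gdist adj x y = 0"
  with tree_walk_gdist[OF assms, of x y] show "x = y"
    by simp
next
  assume "x = y"
  then have "(adj ^^ 0) x y"
    by simp
  then show "gdist adj x y = 0"
    using gdist_le by fastforce
qed

lemma gdist_triangle:
  assumes "tree adj"
  shows "gdist adj x z \<le> gdist adj x y + gdist adj y z"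
  by (rule gdist_le, rule relpowp_trans) (rule tree_walk_gdist[OF assms])+

lemma gdist_adj_le:
  assumes "tree adj" "adj x y"
  shows "gdist adj x z \<le> Suc (gdist adj y z)"
  by (rule gdist_le, rule relpowp_Suc_I2) (use assms tree_walk_gdist in auto)

lemma tree_adj_sym: "tree adj \<Longrightarrow> adj x y \<Longrightarrow> adj y x"
  unfolding tree_def by (meson sympD)

lemma neighbour_towards:
  assumes "tree adj" "x \<noteq> z"
  obtains y where "adj x y" "gdist adj x z = Suc (gdist adj y z)"
proof -
  obtain k where k: "gdist adj x z = Suc k"
    using assms gdist_eq_0_iff not0_implies_Suc by metis
  then obtain y where y: "adj x y" "(adj ^^ k) y z"
    using tree_walk_gdist[OF assms(1), of x z] relpowp_Suc_D2 by metis
  have "gdist adj y z = k"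
    using gdist_le[OF y(2)] gdist_adj_le[OF assms(1) y(1), of z] k by simp
  with that y k show ?thesis
    by simp
qed

text \<open>Loop erasure.\<close>

lemma rtranclp_imp_distinct_path:
  assumes "R\<^sup>*\<^sup>* a b"
  shows "\<exists>xs. xs \<noteq> [] \<and> distinct xs \<and> successively R xs \<and> hd xs = a \<and> last xs = b"
  using assms
proof (induction rule: converse_rtranclp_induct)
  case base
  show ?case
    by (rule exI[of _ "[b]"]) simp
next
  case (step a c)
  then obtain xs where xs: "xs \<noteq> []" "distinct xs" "successively R xs" "hd xs = c" "last xs = b"
    by blast
  show ?case
  proof (cases "a \<in> set xs")
    case False
    with xs step show ?thesis
      by (intro exI[of _ "a # xs"]) (auto simp: successively_Cons)
  next
    case True
    then obtain us vs where "xs = us @ a # vs"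
      by (meson split_list)
    with xs show ?thesis
      by (intro exI[of _ "a # vs"]) (auto simp: successively_append_iff)
  qed
qed

text \<open>Acyclicity says that deleting a vertex disconnects its neighbours from each other: a walk
  joining two of them, made simple by loop erasure, would close up to a cycle through the vertex.\<close>

lemma neighbours_disconnected:
  assumes "tree adj" "adj x y" "adj x z" "(\<lambda>u v. adj u v \<and> u \<noteq> x \<and> v \<noteq> x)\<^sup>*\<^sup>* y z"
  shows "y = z"
proof (rule ccontr)
  assume "y \<noteq> z"
  let ?R = "\<lambda>u v. adj u v \<and> u \<noteq> x \<and> v \<noteq> x"
  obtain xs where xs: "xs \<noteq> []" "distinct xs" "successively ?R xs" "hd xs = y" "last xs = z"
    using rtranclp_imp_distinct_path[OF assms(4)] by blast
  have "x \<noteq> y" "x \<noteq> z"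
    using assms by (auto simp: tree_def irreflp_def)
  have avoid: "x \<notin> set xs"
    using xs(1,3,4) \<open>x \<noteq> y\<close>
  proof (induction xs arbitrary: y)
    case (Cons a xs)
    then show ?case
      by (cases xs) auto
  qed simp
  have "length xs \<ge> 2"
    using xs \<open>y \<noteq> z\<close> by (cases xs; cases "tl xs") auto
  moreover have "successively adj xs"
    using xs(3) by (rule successively_mono) auto
  ultimately have "is_cycle adj (x # xs)"
    using xs avoid assms tree_adj_sym[OF assms(1,3)]
    by (auto simp: is_cycle_def successively_Cons)
  with assms(1) show False
    by (auto simp: tree_def)
qed

text \<open>A geodesic from \<open>u\<close> to \<open>z\<close> gets strictly closer to \<open>z\<close> after its first vertex, so it cannot
  run through a vertex that is at least as far from \<open>z\<close> as \<open>u\<close> is.\<close>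

lemma walk_avoiding_farther_vertex:
  assumes "tree adj" "x \<noteq> z" "u \<noteq> x" "gdist adj u z \<le> gdist adj x z"
  shows "(\<lambda>u v. adj u v \<and> u \<noteq> x \<and> v \<noteq> x)\<^sup>*\<^sup>* u z"
  using assms(3,4)
proof (induction "gdist adj u z" arbitrary: u rule: less_induct)
  case less
  show ?case
  proof (cases "u = z")
    case False
    then obtain w where w: "adj u w" "gdist adj u z = Suc (gdist adj w z)"
      using neighbour_towards[OF assms(1)] by metis
    then have "w \<noteq> x"
      using less.prems by auto
    with less w show ?thesis
      by (intro converse_rtranclp_into_rtranclp[of _ u w]) auto
  qed simp
qed

text \<open>Two neighbours no farther from \<open>z\<close> than \<open>x\<close> is would both have walks to \<open>z\<close> avoiding \<open>x\<close>, which
  join them to each other. Admitting equal distances matters: it covers the fact that trees are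
  bipartite, by which adjacent vertices never are equally far from \<open>z\<close>.\<close>

lemma neighbour_towards_unique:
  assumes "tree adj" "x \<noteq> z" "adj x y" "adj x y'"
    and "gdist adj y z \<le> gdist adj x z" "gdist adj y' z \<le> gdist adj x z"
  shows "y = y'"
proof -
  let ?R = "\<lambda>u v. adj u v \<and> u \<noteq> x \<and> v \<noteq> x"
  have ne: "y \<noteq> x" "y' \<noteq> x"
    using assms by (auto simp: tree_def irreflp_def)
  have "symp ?R"
    using tree_adj_sym[OF assms(1)] by (auto simp: symp_def)
  then have "symp ?R\<^sup>*\<^sup>*"
    by (rule symp_rtranclp)
  moreover have "?R\<^sup>*\<^sup>* y z" "?R\<^sup>*\<^sup>* y' z"
    using walk_avoiding_farther_vertex[OF assms(1,2)] ne assms by auto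
  ultimately have "?R\<^sup>*\<^sup>* y y'"
    by (meson rtranclp_trans sympD)
  with assms show ?thesis
    by (intro neighbours_disconnected)
qed

section \<open>The level function and the parent map\<close>

locale rooted_tree =
  fixes adj :: "'v \<Rightarrow> 'v \<Rightarrow> bool" and v0 :: 'v and \<omega> :: "(nat \<Rightarrow> 'v) set"
  assumes tree: "tree adj" and boundary: "\<omega> \<in> boundary adj v0"
begin

abbreviation "ray \<equiv> ray_to \<omega>"
abbreviation "\<l> \<equiv> level adj \<omega>"
abbreviation "\<pp> \<equiv> pred adj \<omega>"

text \<open>At a vertex \<open>x\<close> where two equivalent rays meet, both continue towards a common vertex ahead,
  hence through the same neighbour of \<open>x\<close>.\<close>

lemma ray_equiv_imp_eq:
  assumes "(r, r') \<in> ray_equiv adj v0"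
  shows "r = r'"
proof
  fix i
  from assms have r: "r 0 = v0" "\<And>i j. i \<le> j \<Longrightarrow> gdist adj (r i) (r j) = j - i"
    and r': "r' 0 = v0" "\<And>i j. i \<le> j \<Longrightarrow> gdist adj (r' i) (r' j) = j - i"
    and "eventually (\<lambda>n. r n = r' n) sequentially"
    unfolding ray_equiv_def geodesic_rays_def by auto
  then obtain N where N: "N \<ge> i" "r N = r' N"
    unfolding eventually_sequentially by (meson nat_le_linear)
  have step: "adj (s k) (s (Suc k))" if "\<And>i j. i \<le> j \<Longrightarrow> gdist adj (s i) (s j) = j - i" for s k
    using tree_walk_gdist[OF tree, of "s k" "s (Suc k)"] that[of k "Suc k"] by (simp add: eq_OO)
  have "j \<le> N \<Longrightarrow> r j = r' j" for j
  proof (induction j)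
    case 0
    show ?case
      using r(1) r'(1) by simp
  next
    case (Suc j)
    then have eq: "r j = r' j"
      by simp
    have "r j \<noteq> r N"
      using r(2)[of j N] Suc.prems gdist_eq_0_iff[OF tree, of "r j" "r N"] by auto
    moreover have "adj (r j) (r (Suc j))"
      by (rule step) (rule r(2))
    moreover have "adj (r' j) (r' (Suc j))"
      by (rule step) (rule r'(2))
    then have "adj (r j) (r' (Suc j))"
      by (simp only: eq)
    moreover have "gdist adj (r (Suc j)) (r N) \<le> gdist adj (r j) (r N)"
      using r(2)[of "Suc j" N] r(2)[of j N] Suc.prems by simp
    moreover have "gdist adj (r' (Suc j)) (r N) \<le> gdist adj (r j) (r N)"
      using r'(2)[of "Suc j" N] r(2)[of j N] Suc.prems N by simp
    ultimately show ?case
      by (rule neighbour_towards_unique[OF tree])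
  qed
  with N show "r i = r' i"
    by simp
qed

lemma gdist_ray: "i \<le> j \<Longrightarrow> gdist adj (ray i) (ray j) = j - i"
proof -
  assume "i \<le> j"
  obtain r where r: "r \<in> geodesic_rays adj v0" and \<omega>: "\<omega> = ray_equiv adj v0 `` {r}"
    using boundary unfolding boundary_def by (elim quotientE)
  have "\<omega> = {r}"
    using r ray_equiv_imp_eq unfolding \<omega> by (auto simp: ray_equiv_def)
  then have "ray = r"
    by (simp add: ray_to_def)
  with r \<open>i \<le> j\<close> show ?thesis
    by (simp add: geodesic_rays_def)
qed

text \<open>The level is a Busemann function: along the ray, \<open>n - d(x, x\<^sub>n)\<close> never decreases, by the triangle
  inequality, and is bounded by \<open>d(x\<^sub>0, x)\<close>, so it is finally constant. From here on, statements on
  levels are statements on distances to a sufficiently remote vertex of the ray.\<close>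

lemma eventually_gdist_ray: "eventually (\<lambda>n. int (gdist adj x (ray n)) = int n - \<l> x) sequentially"
proof -
  define b where "b n = int n - int (gdist adj x (ray n))" for n
  have "b n \<le> b (Suc n)" for n
    using gdist_triangle[OF tree, of x "ray (Suc n)" "ray n"] gdist_ray[of n "Suc n"]
    by (simp add: b_def)
  then have mono: "incseq b"
    by (rule incseq_SucI)
  have bound: "b n \<le> int (gdist adj (ray 0) x)" for n
    using gdist_triangle[OF tree, of "ray 0" "ray n" x] gdist_ray[of 0 n] by (simp add: b_def)
  \<comment> \<open>a bounded increasing sequence of integers stops at its maximum\<close>
  have "finite (range b)"
    by (rule finite_subset[of _ "{b 0..int (gdist adj (ray 0) x)}"])
      (use bound mono in \<open>auto simp: incseq_def\<close>)
  then have "Max (range b) \<in> range b" and le_Max: "\<And>n. b n \<le> Max (range b)"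
    by (auto intro: Max_in)
  from this(1) obtain N where "Max (range b) = b N"
    by (rule imageE)
  with le_Max have N: "b n \<le> b N" for n
    by simp
  have "b n = b N" if "n \<ge> N" for n
    using N[of n] incseqD[OF mono that] by (rule antisym)
  then have ev: "eventually (\<lambda>n. b n = b N) sequentially"
    unfolding eventually_sequentially by blast
  then have "b \<longlonglongrightarrow> b N"
    by (rule tendsto_eventually)
  then have "lim b = b N"
    by (rule limI)
  moreover have "lim b = \<l> x"
    by (simp add: level_def b_def[abs_def])
  ultimately have level: "\<l> x = b N"
    by simp
  from ev show ?thesis
  proof eventually_elim
    case (elim n)
    then show ?case
      unfolding level by (simp add: b_def)
  qed
qed

lemma eventually_ray_neq: "eventually (\<lambda>n. x \<noteq> ray n) sequentially"
  using eventually_gdist_ray[of x] eventually_gt_at_top[of "nat (\<l> x)"]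
proof eventually_elim
  case (elim n)
  then show ?case
    using gdist_eq_0_iff[OF tree, of x "ray n"] by auto
qed

text \<open>Once \<open>x\<close> is known to have a neighbour above it, this excludes both a second neighbour
  above \<open>x\<close> and a neighbour on the level of \<open>x\<close>.\<close>

lemma adj_level_unique:
  assumes "adj x y" "adj x y'" "\<l> y \<ge> \<l> x" "\<l> y' \<ge> \<l> x"
  shows "y = y'"
proof -
  have "eventually (\<lambda>n. y = y') sequentially"
    using eventually_gdist_ray[of x] eventually_gdist_ray[of y] eventually_gdist_ray[of y']
      eventually_ray_neq[of x]
  proof eventually_elim
    case (elim n)
    with assms show ?case
      by (intro neighbour_towards_unique[OF tree, of x "ray n"]) auto
  qed
  then show ?thesis
    by simp
qed

text \<open>The first step \<open>y\<close> of a geodesic from \<open>x\<close> to a remote \<open>x\<^sub>N\<close> also leads towards each later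
  vertex \<open>x\<^sub>n\<close> of the ray: \<open>d(y, x\<^sub>n) \<le> d(y, x\<^sub>N) + (n - N)\<close> is smaller than
  \<open>d(x, x\<^sub>n) = d(x, x\<^sub>N) + (n - N)\<close>.\<close>

lemma ex_adj_higher: "\<exists>y. adj x y \<and> \<l> y = \<l> x + 1"
proof -
  obtain N where N: "\<And>n. n \<ge> N \<Longrightarrow> int (gdist adj x (ray n)) = int n - \<l> x" "x \<noteq> ray N"
    using eventually_conj[OF eventually_gdist_ray[of x] eventually_ray_neq[of x]]
    by (auto simp: eventually_sequentially)
  obtain y where y: "adj x y" "gdist adj x (ray N) = Suc (gdist adj y (ray N))"
    using neighbour_towards[OF tree N(2)] by metis
  have "eventually (\<lambda>n. \<l> y = \<l> x + 1) sequentially"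
    using eventually_gdist_ray[of y] eventually_ge_at_top[of N]
  proof eventually_elim
    case (elim n)
    have "gdist adj y (ray n) \<le> gdist adj y (ray N) + (n - N)"
      using gdist_triangle[OF tree, of y "ray n" "ray N"] gdist_ray[of N n] elim by simp
    moreover have "gdist adj x (ray n) \<le> Suc (gdist adj y (ray n))"
      by (rule gdist_adj_le[OF tree y(1)])
    ultimately show ?case
      using N(1)[of n] N(1)[of N] y(2) elim by linarith
  qed
  with y show ?thesis
    by auto
qed

lemma pred_adj_level: "adj x (\<pp> x) \<and> \<l> (\<pp> x) = \<l> x + 1"
proof -
  have "\<exists>!y. adj x y \<and> \<l> y = \<l> x + 1"
    using ex_adj_higher[of x] adj_level_unique[of x] by (metis less_add_one less_imp_le)
  then show ?thesis
    unfolding pred_def by (rule theI')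
qed

lemma adj_pred [simp]: "adj x (\<pp> x)"
  and level_pred [simp]: "\<l> (\<pp> x) = \<l> x + 1"
  using pred_adj_level by auto

lemma pred_eqI: "adj x y \<Longrightarrow> \<l> y \<ge> \<l> x \<Longrightarrow> \<pp> x = y"
  by (rule adj_level_unique[of x]) auto

lemma level_pred_funpow [simp]: "\<l> ((\<pp> ^^ n) x) = \<l> x + int n"
  by (induction n) auto

lemma succs_eq: "succs adj \<omega> x = {y. \<pp> y = x}"
proof (intro set_eqI iffI)
  fix y assume "y \<in> succs adj \<omega> x"
  then have y: "adj x y" "y \<noteq> \<pp> x"
    by (auto simp: succs_def)
  then have "\<l> y \<le> \<l> x"
    using pred_eqI[of x y] by (cases "\<l> y \<le> \<l> x") auto
  with y show "y \<in> {y. \<pp> y = x}"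
    using pred_eqI[of y x] tree_adj_sym[OF tree] by blast
next
  fix y assume "y \<in> {y. \<pp> y = x}"
  then have y: "\<pp> y = x"
    by simp
  have "\<l> (\<pp> x) = \<l> y + 2"
    unfolding y[symmetric] by simp
  then have "y \<noteq> \<pp> x"
    by auto
  with y show "y \<in> succs adj \<omega> x"
    using adj_pred[of y] tree_adj_sym[OF tree] by (auto simp: succs_def)
qed

lemma succs_n_eq: "succs_n adj \<omega> n x = {y. (\<pp> ^^ n) y = x}"
  by (induction n) (auto simp: succs_eq funpow_swap1)

lemma sector_eq: "sector adj \<omega> x = {y. \<exists>n. (\<pp> ^^ n) y = x}"
  by (auto simp: sector_def succs_n_eq)

end

section \<open>The kernel of common ancestors\<close>

lemma nn_integral_count_space_swap:
  "(\<integral>\<^sup>+x. \<integral>\<^sup>+y. f x y \<partial>count_space UNIV \<partial>count_space UNIV)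
     = (\<integral>\<^sup>+y. \<integral>\<^sup>+x. f x y \<partial>count_space UNIV \<partial>count_space UNIV)"
  using nn_integral_fst_count_space[of "\<lambda>(x, y). f x y"]
    nn_integral_snd_count_space[of "\<lambda>(x, y). f x y"] by simp

text \<open>The sum of \<open>w\<close> over the common ancestors of \<open>x\<close> and \<open>y\<close>, when \<open>P\<close> is the parent map of a
  forest with levels: a common ancestor then is \<open>P\<^sup>j x = P\<^sup>n y\<close> for a single pair \<open>(j, n)\<close>. Summing over
  pairs makes the kernel visibly symmetric and keeps the height above \<open>x\<close> and the depth of \<open>y\<close>
  separate.\<close>

definition ancestor_kernel :: "('v \<Rightarrow> 'v) \<Rightarrow> ('v \<Rightarrow> real) \<Rightarrow> 'v \<Rightarrow> 'v \<Rightarrow> ennreal" where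
  "ancestor_kernel P w x y =
     (\<integral>\<^sup>+j. \<integral>\<^sup>+n. (if (P ^^ j) x = (P ^^ n) y then ennreal (w ((P ^^ j) x)) else 0)
        \<partial>count_space UNIV \<partial>count_space UNIV)"

lemma ancestor_kernel_sym: "ancestor_kernel P w x y = ancestor_kernel P w y x"
  unfolding ancestor_kernel_def
  by (subst nn_integral_count_space_swap) (intro nn_integral_cong, auto)

lemma sum_descendants_le:
  fixes P :: "'v \<Rightarrow> 'v" and g :: "'v \<Rightarrow> real"
  assumes fin: "\<And>v. finite {y. P y = v}"
    and g: "\<And>v. (\<Sum>y | P y = v. g y) \<le> \<rho> * g v" and "\<rho> \<ge> 0"
  shows "finite {y. (P ^^ n) y = v} \<and> (\<Sum>y | (P ^^ n) y = v. g y) \<le> \<rho> ^ n * g v"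
proof (induction n)
  case 0
  show ?case
    by simp
next
  case (Suc n)
  let ?S = "{y. (P ^^ Suc n) y = v}" and ?T = "{y. (P ^^ n) y = v}"
  have "?S = (\<Union>u\<in>?T. {y. P y = u})"
    by (auto simp: funpow_swap1)
  with Suc fin have finS: "finite ?S"
    by simp
  have "(\<Sum>y\<in>?S. g y) = (\<Sum>u\<in>?T. \<Sum>y | y \<in> ?S \<and> P y = u. g y)"
    by (rule sum.group[symmetric]) (use finS Suc in \<open>auto simp: funpow_swap1\<close>)
  also have "\<dots> = (\<Sum>u\<in>?T. \<Sum>y | P y = u. g y)"
    by (intro sum.cong arg_cong[where f = "sum g"]) (auto simp: funpow_swap1)
  also have "\<dots> \<le> (\<Sum>u\<in>?T. \<rho> * g u)"
    by (intro sum_mono g)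
  also have "\<dots> = \<rho> * (\<Sum>u\<in>?T. g u)"
    by (simp add: sum_distrib_left)
  also have "\<dots> \<le> \<rho> * (\<rho> ^ n * g v)"
    using Suc \<open>\<rho> \<ge> 0\<close> by (intro mult_left_mono) auto
  finally show ?case
    using finS by (simp add: mult.assoc)
qed

lemma nn_integral_geometric:
  fixes r :: real
  assumes "0 \<le> r" "r < 1" "0 \<le> c"
  shows "(\<integral>\<^sup>+n. ennreal (c * r ^ n) \<partial>count_space UNIV) = ennreal (c / (1 - r))"
proof -
  have "(\<lambda>n. c * r ^ n) sums (c * (1 / (1 - r)))"
    using assms by (intro sums_mult geometric_sums) auto
  then show ?thesis
    using assms by (simp add: nn_integral_count_space_nat suminf_ennreal_eq sums_unique[symmetric])
qed

text \<open>Sort the points \<open>y\<close> by their common ancestor \<open>v = P\<^sup>j x\<close> and their depth \<open>n\<close> below it. One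
  generation further down costs a factor \<open>\<rho>\<close> and one ancestor further up a factor \<open>\<theta>\<close>, so the pair
  \<open>(j, n)\<close> contributes at most \<open>\<theta>\<^sup>j \<rho>\<^sup>n w(x) g(x)\<close>, and the double series is geometric.\<close>

lemma nn_integral_ancestor_kernel_le:
  fixes P :: "'v \<Rightarrow> 'v" and g w :: "'v \<Rightarrow> real"
  assumes fin: "\<And>v. finite {y. P y = v}"
    and g: "\<And>v. 0 \<le> g v" and w: "\<And>v. 0 \<le> w v"
    and sum_g: "\<And>v. (\<Sum>y | P y = v. g y) \<le> \<rho> * g v"
    and wg: "\<And>v. w (P v) * g (P v) \<le> \<theta> * (w v * g v)"
    and "0 \<le> \<rho>" "\<rho> < 1" "0 \<le> \<theta>" "\<theta> < 1"
  shows "(\<integral>\<^sup>+y. ancestor_kernel P w x y * ennreal (g y) \<partial>count_space UNIV)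
           \<le> ennreal (w x * g x / ((1 - \<rho>) * (1 - \<theta>)))"
proof -
  have wg_pow: "w ((P ^^ j) x) * g ((P ^^ j) x) \<le> \<theta> ^ j * (w x * g x)" for j
  proof (induction j)
    case (Suc j)
    have "w ((P ^^ Suc j) x) * g ((P ^^ Suc j) x) \<le> \<theta> * (w ((P ^^ j) x) * g ((P ^^ j) x))"
      using wg[of "(P ^^ j) x"] by simp
    also have "\<dots> \<le> \<theta> * (\<theta> ^ j * (w x * g x))"
      using Suc \<open>0 \<le> \<theta>\<close> by (rule mult_left_mono)
    finally show ?case
      by (simp add: mult.assoc)
  qed simp
  have inner: "(\<integral>\<^sup>+y. (if (P ^^ j) x = (P ^^ n) y then ennreal (w ((P ^^ j) x)) else 0) * ennreal (g y)
       \<partial>count_space UNIV) \<le> ennreal (w x * g x * \<theta> ^ j * \<rho> ^ n)" (is "?I \<le> _") for j n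
  proof -
    let ?v = "(P ^^ j) x"
    note desc = sum_descendants_le[of P g \<rho> n ?v, OF fin sum_g \<open>0 \<le> \<rho>\<close>]
    have "?I = (\<integral>\<^sup>+y. ennreal (w ?v * g y) * indicator {y. (P ^^ n) y = ?v} y \<partial>count_space UNIV)"
      by (intro nn_integral_cong) (auto simp: ennreal_mult g w indicator_def)
    also have "\<dots> = (\<integral>\<^sup>+y. ennreal (w ?v * g y) \<partial>count_space {y. (P ^^ n) y = ?v})"
      by (simp add: nn_integral_count_space_indicator)
    also have "\<dots> = (\<Sum>y | (P ^^ n) y = ?v. ennreal (w ?v * g y))"
      using desc by (intro nn_integral_count_space_finite) simp
    also have "\<dots> = ennreal (w ?v * (\<Sum>y | (P ^^ n) y = ?v. g y))"
      by (simp add: sum_distrib_left g w)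
    also have "\<dots> \<le> ennreal (w ?v * (\<rho> ^ n * g ?v))"
      using desc w by (intro ennreal_leI mult_left_mono) auto
    also have "\<dots> \<le> ennreal (w x * g x * \<theta> ^ j * \<rho> ^ n)"
      using mult_right_mono[OF wg_pow[of j], of "\<rho> ^ n"] \<open>0 \<le> \<rho>\<close>
      by (intro ennreal_leI) (simp add: algebra_simps)
    finally show ?thesis .
  qed
  have "(\<integral>\<^sup>+y. ancestor_kernel P w x y * ennreal (g y) \<partial>count_space UNIV)
      = (\<integral>\<^sup>+y. \<integral>\<^sup>+j. \<integral>\<^sup>+n. (if (P ^^ j) x = (P ^^ n) y then ennreal (w ((P ^^ j) x)) else 0)
           * ennreal (g y) \<partial>count_space UNIV \<partial>count_space UNIV \<partial>count_space UNIV)"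
    unfolding ancestor_kernel_def by (simp add: nn_integral_multc)
  also have "\<dots> = (\<integral>\<^sup>+j. \<integral>\<^sup>+y. \<integral>\<^sup>+n. (if (P ^^ j) x = (P ^^ n) y then ennreal (w ((P ^^ j) x)) else 0)
           * ennreal (g y) \<partial>count_space UNIV \<partial>count_space UNIV \<partial>count_space UNIV)"
    by (rule nn_integral_count_space_swap)
  also have "\<dots> = (\<integral>\<^sup>+j. \<integral>\<^sup>+n. \<integral>\<^sup>+y. (if (P ^^ j) x = (P ^^ n) y then ennreal (w ((P ^^ j) x)) else 0)
           * ennreal (g y) \<partial>count_space UNIV \<partial>count_space UNIV \<partial>count_space UNIV)"
    by (intro nn_integral_cong nn_integral_count_space_swap)
  also have "\<dots> \<le> (\<integral>\<^sup>+j. \<integral>\<^sup>+n. ennreal (w x * g x * \<theta> ^ j * \<rho> ^ n)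
      \<partial>count_space UNIV \<partial>count_space UNIV)"
    by (intro nn_integral_mono inner)
  also have "\<dots> = (\<integral>\<^sup>+j. ennreal (w x * g x / (1 - \<rho>) * \<theta> ^ j) \<partial>count_space UNIV)"
    using assms(6-9) by (intro nn_integral_cong) (simp add: nn_integral_geometric g w)
  also have "\<dots> = ennreal (w x * g x / (1 - \<rho>) / (1 - \<theta>))"
    using assms(6-9) by (intro nn_integral_geometric) (auto simp: g w)
  finally show ?thesis
    by simp
qed

section \<open>Schur's test\<close>

text \<open>Young's inequality \<open>g \<le> s\<^bsup>1-p\<^esup> g\<^sup>p / p + s (1 - 1/p)\<close>, integrated against \<open>w\<close>, and then
  optimized in \<open>s\<close>; the optimal value is \<open>s = (B / W)\<^bsup>1/p\<^esup>\<close>.\<close>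

lemma nn_integral_Jensen_powr:
  fixes w :: "'v \<Rightarrow> ennreal" and g :: "'v \<Rightarrow> real"
  assumes "1 < p" and [measurable]: "w \<in> borel_measurable M" "g \<in> borel_measurable M"
    and g: "\<And>y. 0 \<le> g y"
    and W: "(\<integral>\<^sup>+y. w y \<partial>M) \<le> ennreal W" "0 < W"
    and B: "(\<integral>\<^sup>+y. w y * ennreal (g y powr p) \<partial>M) \<le> ennreal B" "0 \<le> B"
  shows "(\<integral>\<^sup>+y. w y * ennreal (g y) \<partial>M) \<le> ennreal ((W powr (p - 1) * B) powr (1 / p))"
proof (cases "B = 0")
  case True
  with B have "AE y in M. w y * ennreal (g y powr p) = 0"
    by (subst nn_integral_0_iff_AE[symmetric]) auto
  then have "AE y in M. w y * ennreal (g y) = 0"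
    by eventually_elim (use g in \<open>auto simp: ennreal_eq_0_iff\<close>)
  then have "(\<integral>\<^sup>+y. w y * ennreal (g y) \<partial>M) = 0"
    by (subst nn_integral_0_iff_AE) auto
  then show ?thesis
    by simp
next
  case False
  with B have "0 < B"
    by simp
  define s where "s = (B / W) powr (1 / p)"
  have "0 < s"
    using \<open>0 < B\<close> W by (simp add: s_def)
  have young: "g y \<le> s powr (1 - p) / p * g y powr p + s * (1 - 1 / p)" for y
  proof -
    have "g y / s * 1 \<le> (g y / s) powr p / p + 1 powr (1 / (1 - 1 / p)) / (1 / (1 - 1 / p))"
      using \<open>1 < p\<close> \<open>0 < s\<close> g by (intro Youngs_inequality) (auto simp: field_simps)
    then have "s * (g y / s) \<le> s * ((g y / s) powr p / p + (1 - 1 / p))"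
      using \<open>0 < s\<close> by (intro mult_left_mono) auto
    then show ?thesis
      using \<open>0 < s\<close> g \<open>1 < p\<close> by (simp add: powr_divide powr_diff field_simps)
  qed
  have "(\<integral>\<^sup>+y. w y * ennreal (g y) \<partial>M)
      \<le> (\<integral>\<^sup>+y. ennreal (s powr (1 - p) / p) * (w y * ennreal (g y powr p))
            + ennreal (s * (1 - 1 / p)) * w y \<partial>M)"
  proof (rule nn_integral_mono)
    fix y
    have "ennreal (g y) \<le> ennreal (s powr (1 - p) / p) * ennreal (g y powr p) + ennreal (s * (1 - 1 / p))"
      using young[of y] \<open>0 < s\<close> \<open>1 < p\<close>
      by (simp add: ennreal_mult[symmetric] ennreal_plus[symmetric] ennreal_leI del: ennreal_plus)
    then show "w y * ennreal (g y) \<le> ennreal (s powr (1 - p) / p) * (w y * ennreal (g y powr p))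
            + ennreal (s * (1 - 1 / p)) * w y"
      by (metis (no_types, lifting) distrib_left mult.assoc mult.commute mult_left_mono zero_le)
  qed
  also have "\<dots> = ennreal (s powr (1 - p) / p) * (\<integral>\<^sup>+y. w y * ennreal (g y powr p) \<partial>M)
            + ennreal (s * (1 - 1 / p)) * (\<integral>\<^sup>+y. w y \<partial>M)"
    by (simp add: nn_integral_add nn_integral_cmult)
  also have "\<dots> \<le> ennreal (s powr (1 - p) / p) * ennreal B + ennreal (s * (1 - 1 / p)) * ennreal W"
    by (intro add_mono mult_left_mono W B) auto
  also have "\<dots> = ennreal (s powr (1 - p) / p * B + s * (1 - 1 / p) * W)"
    using \<open>0 < s\<close> \<open>0 < B\<close> \<open>0 < W\<close> \<open>1 < p\<close>
    by (simp add: ennreal_mult[symmetric] ennreal_plus[symmetric] del: ennreal_plus)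
  also have "s powr (1 - p) / p * B + s * (1 - 1 / p) * W = (W powr (p - 1) * B) powr (1 / p)"
  proof -
    let ?c = "(W powr (p - 1) * B) powr (1 / p)"
    have lnc: "ln ?c = ((p - 1) * ln W + ln B) / p"
      using \<open>0 < B\<close> \<open>0 < W\<close> by (simp add: ln_mult ln_powr)
    have lns: "ln s = (ln B - ln W) / p"
      using \<open>0 < B\<close> \<open>0 < W\<close> by (simp add: s_def ln_div ln_powr)
    have "ln (s powr (1 - p) * B) = ln ?c"
      using \<open>0 < B\<close> \<open>0 < s\<close> \<open>1 < p\<close> unfolding lnc
      by (simp add: ln_mult ln_powr lns field_simps)
    then have 1: "s powr (1 - p) * B = ?c"
      using \<open>0 < B\<close> \<open>0 < s\<close> \<open>0 < W\<close> by (subst (asm) ln_inj_iff) auto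
    have "ln (s * W) = ln ?c"
      using \<open>0 < W\<close> \<open>0 < s\<close> \<open>1 < p\<close> unfolding lnc
      by (simp add: ln_mult lns field_simps)
    then have 2: "s * W = ?c"
      using \<open>0 < B\<close> \<open>0 < s\<close> \<open>0 < W\<close> by (subst (asm) ln_inj_iff) auto
    have "s powr (1 - p) / p * B + s * (1 - 1 / p) * W
        = (s powr (1 - p) * B) / p + (s * W) * (1 - 1 / p)"
      by simp
    also have "\<dots> = ?c"
      unfolding 1 2 using \<open>1 < p\<close> by (simp add: field_simps)
    finally show ?thesis .
  qed
  finally show ?thesis .
qed

text \<open>Schur's test for the weights \<open>h\<^bsup>1/p'\<^esup>\<close>, so that the test functions, usually written as the
  powers \<open>p'\<close> and \<open>p\<close> of one weight, are \<open>h\<close> and \<open>h\<^bsup>p-1\<^esup>\<close>. Jensen's inequality for the measure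
  \<open>H(x, \<cdot>) h\<close>, whose mass is at most \<open>C1 h(x)\<close>, applied to \<open>F / h\<close> bounds the power \<open>p\<close> of the
  integral by \<open>(C1 h(x))\<^bsup>p-1\<^esup> B(x)\<close>, where \<open>B(x)\<close> is the integral of \<open>h\<^bsup>1-p\<^esup> F\<^sup>p\<close> against \<open>H(x, \<cdot>)\<close>.
  Interchanging the integrals then makes the second hypothesis applicable.\<close>

lemma Schur_test:
  fixes H :: "'v \<Rightarrow> 'v \<Rightarrow> ennreal" and h u F :: "'v \<Rightarrow> real"
  assumes "1 < p" and h: "\<And>x. 0 < h x" and u: "\<And>x. 0 < u x" and F: "\<And>x. 0 \<le> F x"
    and "0 < C1" "0 \<le> C2"
    and H1: "\<And>x. (\<integral>\<^sup>+y. H x y * ennreal (h y) \<partial>count_space UNIV) \<le> ennreal (C1 * h x)"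
    and H2: "\<And>y. (\<integral>\<^sup>+x. H x y * ennreal (u x * h x powr (p - 1)) \<partial>count_space UNIV)
               \<le> ennreal (C2 * (u y * h y powr (p - 1)))"
    and fin: "(\<integral>\<^sup>+x. ennreal (u x * F x powr p) \<partial>count_space UNIV) < \<infinity>"
  shows "(\<integral>\<^sup>+y. H x y * ennreal (F y) \<partial>count_space UNIV) < \<infinity>" (is ?fin)
    and "(\<integral>\<^sup>+x. ennreal (u x * enn2real (\<integral>\<^sup>+y. H x y * ennreal (F y) \<partial>count_space UNIV) powr p)
            \<partial>count_space UNIV)
         \<le> ennreal (C1 powr (p - 1) * C2) * (\<integral>\<^sup>+x. ennreal (u x * F x powr p) \<partial>count_space UNIV)"
      (is "?lhs \<le> ?rhs")
proof -
  let ?VF = "\<lambda>x. \<integral>\<^sup>+y. H x y * ennreal (F y) \<partial>count_space UNIV"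
  let ?N = "\<integral>\<^sup>+x. ennreal (u x * F x powr p) \<partial>count_space UNIV"
  define B where "B x = (\<integral>\<^sup>+y. H x y * ennreal (h y powr (1 - p) * F y powr p) \<partial>count_space UNIV)" for x
  define v where "v x = u x * h x powr (p - 1)" for x
  have v: "0 < v x" for x
    using u[of x] h[of x] by (simp add: v_def)
  have "(\<integral>\<^sup>+x. ennreal (v x) * B x \<partial>count_space UNIV)
      = (\<integral>\<^sup>+x. \<integral>\<^sup>+y. ennreal (v x) * (H x y * ennreal (h y powr (1 - p) * F y powr p))
           \<partial>count_space UNIV \<partial>count_space UNIV)"
    unfolding B_def by (simp add: nn_integral_cmult)
  also have "\<dots> = (\<integral>\<^sup>+y. \<integral>\<^sup>+x. ennreal (v x) * (H x y * ennreal (h y powr (1 - p) * F y powr p))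
           \<partial>count_space UNIV \<partial>count_space UNIV)"
    by (rule nn_integral_count_space_swap)
  also have "\<dots> = (\<integral>\<^sup>+y. (\<integral>\<^sup>+x. H x y * ennreal (v x) \<partial>count_space UNIV)
           * ennreal (h y powr (1 - p) * F y powr p) \<partial>count_space UNIV)"
    by (simp add: nn_integral_multc[symmetric] ac_simps)
  also have "\<dots> \<le> (\<integral>\<^sup>+y. ennreal (C2 * v y) * ennreal (h y powr (1 - p) * F y powr p)
           \<partial>count_space UNIV)"
    unfolding v_def by (intro nn_integral_mono mult_right_mono H2) auto
  also have "\<dots> = (\<integral>\<^sup>+y. ennreal C2 * ennreal (u y * F y powr p) \<partial>count_space UNIV)"
  proof (rule nn_integral_cong)
    fix y
    have "h y powr (p - 1) * h y powr (1 - p) = 1"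
      using h[of y] by (simp add: powr_add[symmetric])
    then have "C2 * v y * (h y powr (1 - p) * F y powr p) = C2 * (u y * F y powr p)"
      unfolding v_def by (metis (no_types, lifting) mult.assoc mult.commute mult.right_neutral)
    then show "ennreal (C2 * v y) * ennreal (h y powr (1 - p) * F y powr p)
        = ennreal C2 * ennreal (u y * F y powr p)"
      using v[of y] u[of y] \<open>0 \<le> C2\<close> by (simp add: ennreal_mult[symmetric])
  qed
  also have "\<dots> = ennreal C2 * ?N"
    by (simp add: nn_integral_cmult)
  finally have vB: "(\<integral>\<^sup>+x. ennreal (v x) * B x \<partial>count_space UNIV) \<le> ennreal C2 * ?N" .
  \<comment> \<open>As every point has positive mass, a finite integral forces finiteness at each point.\<close>
  have Bfin: "B x < \<infinity>" for x
  proof -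
    have "ennreal (v x) * B x \<le> ennreal C2 * ?N"
      using nn_integral_ge_point[of x UNIV "\<lambda>x. ennreal (v x) * B x"] vB by (auto intro: order_trans)
    also have "\<dots> < \<infinity>"
      using fin by (simp add: ennreal_mult_less_top)
    finally show ?thesis
      using v[of x] by (auto simp: ennreal_mult_less_top)
  qed
  have VF: "?VF x \<le> ennreal (((C1 * h x) powr (p - 1) * enn2real (B x)) powr (1 / p))" for x
  proof -
    have "?VF x = (\<integral>\<^sup>+y. (H x y * ennreal (h y)) * ennreal (F y / h y) \<partial>count_space UNIV)"
    proof (rule nn_integral_cong)
      fix y
      have "ennreal (h y) * ennreal (F y / h y) = ennreal (F y)"
        using h[of y] F[of y] by (simp add: ennreal_mult[symmetric])
      then show "H x y * ennreal (F y) = H x y * ennreal (h y) * ennreal (F y / h y)"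
        by (simp add: mult.assoc)
    qed
    also have "\<dots> \<le> ennreal (((C1 * h x) powr (p - 1) * enn2real (B x)) powr (1 / p))"
    proof (rule nn_integral_Jensen_powr[OF \<open>1 < p\<close>])
      show "(\<integral>\<^sup>+y. H x y * ennreal (h y) * ennreal ((F y / h y) powr p) \<partial>count_space UNIV)
          \<le> ennreal (enn2real (B x))"
      proof -
        have "ennreal (h y) * ennreal ((F y / h y) powr p) = ennreal (h y powr (1 - p) * F y powr p)" for y
          using h[of y] F[of y]
          by (simp add: ennreal_mult[symmetric] powr_divide powr_diff field_simps)
        then have "(\<integral>\<^sup>+y. H x y * ennreal (h y) * ennreal ((F y / h y) powr p) \<partial>count_space UNIV) = B x"
          unfolding B_def by (simp add: mult.assoc)
        then show ?thesis
          using Bfin[of x] by simp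
      qed
    qed (use H1 h F \<open>0 < C1\<close> in \<open>auto intro: divide_nonneg_pos\<close>)
    finally show ?thesis .
  qed
  then show ?fin
    by (rule le_less_trans) simp
  have "?lhs \<le> (\<integral>\<^sup>+x. ennreal (C1 powr (p - 1)) * (ennreal (v x) * B x) \<partial>count_space UNIV)"
  proof (rule nn_integral_mono)
    fix x
    have "enn2real (?VF x) \<le> ((C1 * h x) powr (p - 1) * enn2real (B x)) powr (1 / p)"
      using VF[of x] by (intro enn2real_leI) auto
    then have "enn2real (?VF x) powr p \<le> (((C1 * h x) powr (p - 1) * enn2real (B x)) powr (1 / p)) powr p"
      using \<open>1 < p\<close> by (intro powr_mono2) auto
    also have "\<dots> = C1 powr (p - 1) * h x powr (p - 1) * enn2real (B x)"
      using \<open>1 < p\<close> \<open>0 < C1\<close> h[of x] by (simp add: powr_powr powr_mult)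
    finally have "u x * enn2real (?VF x) powr p \<le> u x * (C1 powr (p - 1) * h x powr (p - 1) * enn2real (B x))"
      using u[of x] by (intro mult_left_mono) auto
    also have "\<dots> = C1 powr (p - 1) * (v x * enn2real (B x))"
      by (simp add: v_def)
    finally have "ennreal (u x * enn2real (?VF x) powr p) \<le> ennreal (C1 powr (p - 1) * (v x * enn2real (B x)))"
      by (rule ennreal_leI)
    also have "\<dots> = ennreal (C1 powr (p - 1)) * (ennreal (v x) * B x)"
      using v[of x] Bfin[of x] by (simp add: ennreal_mult)
    finally show "ennreal (u x * enn2real (?VF x) powr p)
        \<le> ennreal (C1 powr (p - 1)) * (ennreal (v x) * B x)" .
  qed
  also have "\<dots> = ennreal (C1 powr (p - 1)) * (\<integral>\<^sup>+x. ennreal (v x) * B x \<partial>count_space UNIV)"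
    by (simp add: nn_integral_cmult)
  also have "\<dots> \<le> ennreal (C1 powr (p - 1)) * (ennreal C2 * ?N)"
    by (intro mult_left_mono vB) auto
  also have "\<dots> = ?rhs"
    using \<open>0 \<le> C2\<close> by (simp add: ennreal_mult mult.assoc)
  finally show "?lhs \<le> ?rhs" .
qed

section \<open>Pointwise bound for the Bergman kernel\<close>

lemma S_sum_powi:
  assumes "1 < kc"
  shows "S_sum adj \<omega> (\<lambda>n. kc powi n) n x = kc powi (level adj \<omega> x + n) / (1 - 1 / kc)"
proof -
  let ?a = "level adj \<omega> x + n"
  have "(\<lambda>k. kc powi ?a * (1 / kc) ^ k) sums (kc powi ?a * (1 / (1 - 1 / kc)))"
    using assms by (intro sums_mult geometric_sums) auto
  moreover have "(\<lambda>k. kc powi ?a * (1 / kc) ^ k) = (\<lambda>k. kc powi (?a - int k))"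
    using assms by (auto simp: power_int_diff power_divide)
  ultimately have "(\<lambda>k. kc powi (?a - int k)) sums (kc powi ?a * (1 / (1 - 1 / kc)))"
    by (simp only:)
  then show ?thesis
    unfolding S_sum_def by (subst sums_unique[symmetric]) simp_all
qed

lemma ennreal_abs_suminf_le: "ennreal \<bar>suminf f\<bar> \<le> (\<Sum>n. ennreal \<bar>f n\<bar>)"
proof (cases "(\<Sum>n. ennreal \<bar>f n\<bar>) = top")
  case False
  then have summable: "summable (\<lambda>n. \<bar>f n\<bar>)"
    by (intro summable_suminf_not_top) auto
  have "ennreal \<bar>suminf f\<bar> \<le> ennreal (\<Sum>n. \<bar>f n\<bar>)"
    by (intro ennreal_leI summable_rabs summable)
  also have "\<dots> = (\<Sum>n. ennreal \<bar>f n\<bar>)"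
    using False by (intro suminf_ennreal[symmetric]) auto
  finally show ?thesis .
qed simp

locale rooted_flow = rooted_tree adj v0 \<omega>
  for adj :: "'v \<Rightarrow> 'v \<Rightarrow> bool" and v0 :: 'v and \<omega> :: "(nat \<Rightarrow> 'v) set" +
  fixes m :: "'v \<Rightarrow> real"
  assumes locally_finite: "locally_finite adj" and flow: "flow_measure adj \<omega> m"
begin

lemma m_pos [simp]: "0 < m x"
  using flow unfolding flow_measure_def by blast

lemma m_nonneg [simp]: "0 \<le> m x"
  using m_pos[of x] by (rule less_imp_le)

lemma m_neq_0 [simp]: "m x \<noteq> 0"
  using m_pos[of x] by linarith

lemma finite_succs: "finite {y. \<pp> y = x}"
proof (rule finite_subset)
  show "{y. \<pp> y = x} \<subseteq> {y. adj x y}"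
    unfolding succs_eq[symmetric] by (auto simp: succs_def)
  show "finite {y. adj x y}"
    using locally_finite by (simp add: locally_finite_def)
qed

lemma sum_m_succs: "(\<Sum>y | \<pp> y = x. m y) = m x"
proof -
  have "m x = (\<Sum>y\<in>succs adj \<omega> x. m y)"
    using flow unfolding flow_measure_def by blast
  then show ?thesis
    by (simp only: succs_eq)
qed

lemma m_le_m_pred: "m x \<le> m (\<pp> x)"
  unfolding sum_m_succs[of "\<pp> x", symmetric]
  by (rule member_le_sum) (auto simp: finite_succs)

text \<open>Cancellation between the two terms of \<open>\<Psi>\<close> is not worth keeping: each is bounded on its own
  sector.\<close>

lemma abs_Psi_le:
  fixes v z y :: 'v
  defines "v \<equiv> \<pp> z"
  shows "\<bar>Psi adj \<omega> m v z y\<bar>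
      \<le> of_bool (y \<in> sector adj \<omega> z) / m z + of_bool (y \<in> sector adj \<omega> v) / m v"
proof (cases "{y, z} \<subseteq> punctured_sector adj \<omega> v")
  case True
  then have y: "y \<in> sector adj \<omega> v"
    by (auto simp: punctured_sector_def)
  \<comment> \<open>So the definite description in \<open>Psi\<close>, where it applies, denotes \<open>z\<close>.\<close>
  have only_z: "u = z" if u: "\<pp> u = v" "z \<in> sector adj \<omega> u" for u
  proof -
    obtain k where k: "(\<pp> ^^ k) z = u"
      using u(2) by (auto simp: sector_eq)
    have "\<l> (\<pp> u) = \<l> (\<pp> z)"
      by (simp only: u(1) v_def)
    moreover have "\<l> u = \<l> z + int k"
      unfolding k[symmetric] by (rule level_pred_funpow)
    ultimately have "k = 0"
      by simp
    with k show ?thesis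
      by simp
  qed
  have z: "\<pp> z = v" "z \<in> sector adj \<omega> z"
    unfolding v_def sector_eq by (simp_all add: exI[of _ 0])
  show ?thesis
  proof (cases "y \<in> sector adj \<omega> z")
    case yz: True
    have "(THE u. u \<in> succs adj \<omega> v \<and> {y, z} \<subseteq> sector adj \<omega> u) = z"
      unfolding succs_eq using z yz only_z by (intro the_equality) blast+
    moreover have "\<exists>u\<in>succs adj \<omega> v. {y, z} \<subseteq> sector adj \<omega> u"
      using z yz by (auto simp: succs_eq)
    ultimately have "Psi adj \<omega> m v z y = 1 / m z - 1 / m v"
      using True by (simp add: Psi_def)
    then show ?thesis
      using y yz abs_triangle_ineq4[of "1 / m z" "1 / m v"] by simp
  next
    case False
    then have "\<not> (\<exists>u\<in>succs adj \<omega> v. {y, z} \<subseteq> sector adj \<omega> u)"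
      unfolding succs_eq using only_z by blast
    then have "Psi adj \<omega> m v z y = - (1 / m v)"
      using True unfolding Psi_def by (simp only: if_True if_False not_True_eq_False)
    then show ?thesis
      using y by simp
  qed
next
  case False
  then have "Psi adj \<omega> m v z y = 0"
    unfolding Psi_def by (simp only: if_True not_False_eq_True)
  then show ?thesis
    by simp
qed

definition ancestor_weight :: "real \<Rightarrow> 'v \<Rightarrow> real" where
  "ancestor_weight kc v = kc powi (- \<l> v) / m v"

text \<open>The \<open>n\<close>-th term of the kernel is supported where \<open>p\<^sup>n x\<close> or \<open>p\<^bsup>n+1\<^esup> x\<close> is an ancestor of \<open>y\<close>, and
  \<open>S\<^bsub>n,x\<^esub>\<close> is at least \<open>kc\<^bsup>\<l>(x)+n\<^esup>\<close>. So the two parts of \<open>\<Psi>\<close> contribute at most the weights of these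
  two ancestors; the second one is one level higher, which accounts for the factor \<open>kc\<close>.\<close>

lemma abs_bergman_kernel_le:
  assumes "1 < kc"
  shows "ennreal \<bar>bergman_kernel adj \<omega> m (\<lambda>n. kc powi n) x y\<bar>
      \<le> ennreal (1 + kc) * ancestor_kernel \<pp> (ancestor_weight kc) x y"
proof -
  let ?w = "ancestor_weight kc" and ?G = "ancestor_kernel \<pp> (ancestor_weight kc) x y"
  let ?t = "\<lambda>n. Psi adj \<omega> m ((\<pp> ^^ Suc n) x) ((\<pp> ^^ n) x) y / S_sum adj \<omega> (\<lambda>n. kc powi n) (int n) x"
  define e where "e n = of_bool (y \<in> sector adj \<omega> ((\<pp> ^^ n) x)) * ?w ((\<pp> ^^ n) x)" for n
  have w: "0 \<le> ?w v" for v
    using assms by (simp add: ancestor_weight_def)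
  then have e: "0 \<le> e n" for n
    by (simp add: e_def)
  have "(\<Sum>n. ennreal (e n)) = (\<integral>\<^sup>+n. ennreal (e n) \<partial>count_space UNIV)"
    by (simp add: nn_integral_count_space_nat)
  also have "\<dots> \<le> ?G"
    unfolding ancestor_kernel_def
  proof (rule nn_integral_mono)
    fix j
    show "ennreal (e j) \<le> (\<integral>\<^sup>+n. (if (\<pp> ^^ j) x = (\<pp> ^^ n) y then ennreal (?w ((\<pp> ^^ j) x)) else 0)
        \<partial>count_space UNIV)"
    proof (cases "y \<in> sector adj \<omega> ((\<pp> ^^ j) x)")
      case True
      then obtain n where n: "(\<pp> ^^ n) y = (\<pp> ^^ j) x"
        by (auto simp: sector_eq)
      have "ennreal (e j) = (if (\<pp> ^^ j) x = (\<pp> ^^ n) y then ennreal (?w ((\<pp> ^^ j) x)) else 0)"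
        using True n by (simp add: e_def)
      also have "\<dots> \<le> (\<integral>\<^sup>+n. (if (\<pp> ^^ j) x = (\<pp> ^^ n) y then ennreal (?w ((\<pp> ^^ j) x)) else 0)
          \<partial>count_space UNIV)"
        by (rule nn_integral_ge_point) simp
      finally show ?thesis .
    qed (simp add: e_def)
  qed
  finally have sum_e: "(\<Sum>n. ennreal (e n)) \<le> ?G" .
  have summand_le: "\<bar>?t n\<bar> \<le> e n + kc * e (Suc n)" for n
  proof -
    let ?S = "S_sum adj \<omega> (\<lambda>n. kc powi n) (int n) x"
    let ?z = "(\<pp> ^^ n) x"
    define a where "a = kc powi (- \<l> ?z)"
    have "0 < a"
      using assms by (simp add: a_def)
    have "a = inverse (kc powi (\<l> x + int n))"
      by (simp only: a_def level_pred_funpow power_int_minus)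
    then have "1 / ?S = (1 - 1 / kc) * a"
      using assms by (simp add: S_sum_powi divide_inverse)
    moreover have "(1 - 1 / kc) * a \<le> 1 * a" "0 \<le> (1 - 1 / kc) * a"
      using \<open>0 < a\<close> assms by (intro mult_right_mono mult_nonneg_nonneg; simp)+
    ultimately have S: "0 \<le> 1 / ?S" "1 / ?S \<le> a"
      by simp_all
    have "\<bar>?t n\<bar> = \<bar>Psi adj \<omega> m ((\<pp> ^^ Suc n) x) ?z y\<bar> * (1 / ?S)"
      using S(1) by (simp add: abs_mult)
    also have "\<dots> \<le> \<bar>Psi adj \<omega> m ((\<pp> ^^ Suc n) x) ?z y\<bar> * a"
      using S(2) by (rule mult_left_mono) simp
    also have "\<dots> \<le> (of_bool (y \<in> sector adj \<omega> ?z) / m ?z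
        + of_bool (y \<in> sector adj \<omega> (\<pp> ?z)) / m (\<pp> ?z)) * a"
      using abs_Psi_le[of ?z y] \<open>0 < a\<close> by (intro mult_right_mono) auto
    also have "\<dots> = e n + kc * e (Suc n)"
    proof -
      have "kc powi (- \<l> (\<pp> ?z)) = kc powi (- \<l> ?z - 1)"
        by (simp only: level_pred minus_add_distrib diff_conv_add_uminus)
      then have "kc * kc powi (- \<l> (\<pp> ?z)) = a"
        using assms by (simp add: a_def power_int_diff)
      then have "kc * e (Suc n) = of_bool (y \<in> sector adj \<omega> (\<pp> ?z)) / m (\<pp> ?z) * a"
        unfolding e_def ancestor_weight_def funpow.simps o_apply by (simp add: algebra_simps)
      moreover have "e n = of_bool (y \<in> sector adj \<omega> ?z) / m ?z * a"
        unfolding e_def ancestor_weight_def a_def by simp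
      ultimately show ?thesis
        by (simp only: distrib_right)
    qed
    finally show ?thesis .
  qed
  have "(\<Sum>n. ennreal (e (Suc n))) \<le> (\<Sum>n. ennreal (e n))"
    using suminf_offset[of "\<lambda>n. ennreal (e n)" 1] by simp
  then have sum_eS: "(\<Sum>n. ennreal (e (Suc n))) \<le> ?G"
    using sum_e by (rule order_trans)
  have "ennreal \<bar>bergman_kernel adj \<omega> m (\<lambda>n. kc powi n) x y\<bar> \<le> (\<Sum>n. ennreal \<bar>?t n\<bar>)"
    unfolding bergman_kernel_def by (rule ennreal_abs_suminf_le)
  also have "\<dots> \<le> (\<Sum>n. ennreal (e n) + ennreal kc * ennreal (e (Suc n)))"
  proof (intro suminf_le allI)
    fix n
    have "ennreal \<bar>?t n\<bar> \<le> ennreal (e n + kc * e (Suc n))"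
      by (intro ennreal_leI summand_le)
    also have "\<dots> = ennreal (e n) + ennreal kc * ennreal (e (Suc n))"
      using e assms by (simp add: ennreal_mult)
    finally show "ennreal \<bar>?t n\<bar> \<le> ennreal (e n) + ennreal kc * ennreal (e (Suc n))" .
  qed auto
  also have "\<dots> = (\<Sum>n. ennreal (e n)) + ennreal kc * (\<Sum>n. ennreal (e (Suc n)))"
    by (simp add: suminf_add[symmetric])
  also have "\<dots> \<le> ?G + ennreal kc * ?G"
    by (intro add_mono mult_left_mono sum_e sum_eS) simp
  also have "\<dots> = ennreal (1 + kc) * ?G"
    using assms by (simp add: distrib_right)
  finally show ?thesis .
qed

end

section \<open>Boundedness from a power weight\<close>

lemma Lp_space_point_measure_iff:
  assumes "\<And>x. 0 \<le> u x"
  shows "f \<in> Lp_space p (point_measure UNIV (\<lambda>x. ennreal (u x)))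
    \<longleftrightarrow> (\<integral>\<^sup>+x. ennreal (u x * norm (f x) powr p) \<partial>count_space UNIV) < \<infinity>"
  using assms
  by (simp add: Lp_space_def integrable_iff_bounded point_measure_def nn_integral_density ennreal_mult)

lemma Lp_norm_point_measure:
  assumes "\<And>x. 0 \<le> u x"
  shows "Lp_norm p (point_measure UNIV (\<lambda>x. ennreal (u x))) f
    = enn2real (\<integral>\<^sup>+x. ennreal (u x * norm (f x) powr p) \<partial>count_space UNIV) powr (1 / p)"
  using assms
  by (simp add: Lp_norm_def integral_eq_nn_integral point_measure_def nn_integral_density ennreal_mult)

lemma summable_on_norm_nn_integral:
  fixes f :: "'a \<Rightarrow> complex"
  assumes "(\<integral>\<^sup>+y. ennreal (norm (f y)) \<partial>count_space UNIV) < \<infinity>"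
  shows "(\<lambda>y. norm (f y)) summable_on UNIV"
    and "ennreal (norm (infsum f UNIV)) \<le> (\<integral>\<^sup>+y. ennreal (norm (f y)) \<partial>count_space UNIV)"
proof -
  have int: "integrable (count_space UNIV) f"
    using assms by (simp add: integrable_iff_bounded)
  then have abs: "Infinite_Set_Sum.abs_summable_on f UNIV"
    by (simp add: Infinite_Set_Sum.abs_summable_on_def)
  then show "(\<lambda>y. norm (f y)) summable_on UNIV"
    by (simp add: abs_summable_equivalent)
  have "infsum f UNIV = (\<integral>y. f y \<partial>count_space UNIV)"
    using infsetsum_infsum[OF abs] by (simp add: infsetsum_def)
  then show "ennreal (norm (infsum f UNIV)) \<le> (\<integral>\<^sup>+y. ennreal (norm (f y)) \<partial>count_space UNIV)"
    using integral_norm_bound_ennreal[OF int] by simp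
qed

context rooted_flow
begin

text \<open>The mass of the children adds up to that of the parent, so only the level decides about decay
  in both directions; this is the integral in the first condition of Schur's test.\<close>

lemma nn_integral_ancestor_kernel_mass_le:
  assumes "0 < kc" "1 < s" "s < kc"
  shows "(\<integral>\<^sup>+y. ancestor_kernel \<pp> (ancestor_weight kc) x y * ennreal (m y * s powi \<l> y) \<partial>count_space UNIV)
    \<le> ennreal ((s / kc) powi \<l> x / ((1 - 1 / s) * (1 - s / kc)))"
proof -
  have wg: "ancestor_weight kc v * (m v * s powi \<l> v) = (s / kc) powi \<l> v" for v
    using assms by (simp add: ancestor_weight_def power_int_minus power_int_divide_distrib field_simps)
  have "(\<integral>\<^sup>+y. ancestor_kernel \<pp> (ancestor_weight kc) x y * ennreal (m y * s powi \<l> y) \<partial>count_space UNIV)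
    \<le> ennreal (ancestor_weight kc x * (m x * s powi \<l> x) / ((1 - 1 / s) * (1 - s / kc)))"
  proof (rule nn_integral_ancestor_kernel_le)
    fix v
    have "(\<Sum>y | \<pp> y = v. m y * s powi \<l> y) = (\<Sum>y | \<pp> y = v. m y * s powi (\<l> v - 1))"
      by (intro sum.cong) auto
    also have "\<dots> = m v * s powi (\<l> v - 1)"
      by (simp only: sum_distrib_right[symmetric] sum_m_succs)
    also have "\<dots> = 1 / s * (m v * s powi \<l> v)"
      using assms by (simp add: power_int_diff)
    finally show "(\<Sum>y | \<pp> y = v. m y * s powi \<l> y) \<le> 1 / s * (m v * s powi \<l> v)"
      by simp
    show "ancestor_weight kc (\<pp> v) * (m (\<pp> v) * s powi \<l> (\<pp> v))
        \<le> s / kc * (ancestor_weight kc v * (m v * s powi \<l> v))"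
      unfolding wg using assms by (simp add: power_int_add mult_ac)
    show "0 \<le> m v * s powi \<l> v" "0 \<le> ancestor_weight kc v"
      using assms by (simp_all add: ancestor_weight_def)
  qed (use assms finite_succs in auto)
  then show ?thesis
    unfolding wg .
qed

text \<open>The integral in the second condition of Schur's test. The square leaves one factor \<open>m\<close> to be
  estimated vertex by vertex: it is multiplied by at most \<open>D\<close> with each generation down, and by at
  most \<open>C\<close> with each ancestor up.\<close>

lemma nn_integral_ancestor_kernel_mass_sq_le:
  assumes "0 < kc" "0 < C" "0 < D" "D < t" "C * t < kc"
    and C: "\<And>x. m (\<pp> x) \<le> C * m x" and D: "\<And>x. m x \<le> D * m (\<pp> x)"
  shows "(\<integral>\<^sup>+y. ancestor_kernel \<pp> (ancestor_weight kc) x y * ennreal (m y * m y * t powi \<l> y) \<partial>count_space UNIV)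
    \<le> ennreal (m x * (t / kc) powi \<l> x / ((1 - D / t) * (1 - C * t / kc)))"
proof -
  have "0 < t"
    using assms by linarith
  have wg: "ancestor_weight kc v * (m v * m v * t powi \<l> v) = m v * (t / kc) powi \<l> v" for v
    using assms by (simp add: ancestor_weight_def power_int_minus power_int_divide_distrib field_simps)
  have "(\<integral>\<^sup>+y. ancestor_kernel \<pp> (ancestor_weight kc) x y * ennreal (m y * m y * t powi \<l> y) \<partial>count_space UNIV)
    \<le> ennreal (ancestor_weight kc x * (m x * m x * t powi \<l> x) / ((1 - D / t) * (1 - C * t / kc)))"
  proof (rule nn_integral_ancestor_kernel_le)
    fix v
    have "(\<Sum>y | \<pp> y = v. m y * m y * t powi \<l> y) \<le> (\<Sum>y | \<pp> y = v. m y * (D * m v * t powi (\<l> v - 1)))"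
    proof (rule sum_mono)
      fix y assume "y \<in> {y. \<pp> y = v}"
      then have y: "\<pp> y = v" "\<l> y = \<l> v - 1"
        by auto
      then have "m y * (m y * t powi \<l> y) \<le> m y * (D * m v * t powi \<l> y)"
        using D[of y] \<open>0 < t\<close> by (intro mult_left_mono mult_right_mono) auto
      then show "m y * m y * t powi \<l> y \<le> m y * (D * m v * t powi (\<l> v - 1))"
        by (simp add: y(2) mult.assoc)
    qed
    also have "\<dots> = m v * (D * m v * t powi (\<l> v - 1))"
      by (simp only: sum_distrib_right[symmetric] sum_m_succs)
    also have "\<dots> = D / t * (m v * m v * t powi \<l> v)"
      using \<open>0 < t\<close> by (simp add: power_int_diff)
    finally show "(\<Sum>y | \<pp> y = v. m y * m y * t powi \<l> y) \<le> D / t * (m v * m v * t powi \<l> v)" .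
    have "m (\<pp> v) * (t / kc) powi \<l> (\<pp> v) \<le> C * m v * (t / kc) powi \<l> (\<pp> v)"
      using C[of v] \<open>0 < t\<close> \<open>0 < kc\<close> by (intro mult_right_mono) auto
    then show "ancestor_weight kc (\<pp> v) * (m (\<pp> v) * m (\<pp> v) * t powi \<l> (\<pp> v))
        \<le> C * t / kc * (ancestor_weight kc v * (m v * m v * t powi \<l> v))"
      unfolding wg using \<open>0 < t\<close> \<open>0 < kc\<close> by (simp add: power_int_add mult_ac)
    show "0 \<le> m v * m v * t powi \<l> v" "0 \<le> ancestor_weight kc v"
      using assms \<open>0 < t\<close> by (simp_all add: ancestor_weight_def)
  qed (use assms \<open>0 < t\<close> finite_succs in auto)
  then show ?thesis
    unfolding wg .
qed

text \<open>Schur's test with \<open>h = q\<^bsup>\<l>\<^esup>\<close>, for the kernel of the operator with the Bergman kernel replaced by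
  its bound. The two integrals return the test functions up to the factor \<open>m (ka kb / kc)\<^bsup>\<l>\<^esup>\<close>, which is
  what the growth condition bounds.\<close>

lemma V_bounded_if_Schur_weight:
  assumes "0 < ka" "0 < kb" "0 < kd" "1 < kc" "1 < p" "0 < q"
    and C: "0 < C" "\<And>x. m (\<pp> x) \<le> C * m x" and D: "0 < D" "\<And>x. m x \<le> D * m (\<pp> x)"
    and growth: "0 < c0" "\<And>x. m x \<le> c0 * (kc / (kb * ka)) powi \<l> x"
    and s: "1 < kb * q" "kb * q < kc"
    and t: "D < ka * kd * q powr (p - 1)" "C * (ka * kd * q powr (p - 1)) < kc"
  shows "V_bounded adj \<omega> m (\<lambda>n. ka powi n) (\<lambda>n. kb powi n) (\<lambda>n. kc powi n) p (\<lambda>n. kd powi n)"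
proof -
  define s t where "s = kb * q" and "t = ka * kd * q powr (p - 1)"
  have "0 < s" "0 < t"
    using assms by (simp_all add: s_def t_def)
  have growth': "m x * (ka * kb / kc) powi \<l> x \<le> c0" for x
  proof -
    have "m x * (ka * kb / kc) powi \<l> x \<le> c0 * (kc / (kb * ka)) powi \<l> x * (ka * kb / kc) powi \<l> x"
      using assms by (intro mult_right_mono growth) auto
    also have "\<dots> = c0 * ((kc / (kb * ka)) * (ka * kb / kc)) powi \<l> x"
      by (simp only: power_int_mult_distrib mult.assoc)
    also have "(kc / (kb * ka)) * (ka * kb / kc) = 1"
      using assms by simp
    finally show ?thesis
      by simp
  qed
  let ?G = "ancestor_kernel \<pp> (ancestor_weight kc)"
  define H where "H x y = ennreal ((1 + kc) * (m x * ka powi \<l> x)) * (?G x y * ennreal (m y * kb powi \<l> y))" for x y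
  define u where "u x = m x * kd powi \<l> x" for x
  define h where "h x = q powi \<l> x" for x
  define C1 where "C1 = (1 + kc) * c0 / ((1 - 1 / s) * (1 - s / kc))"
  define C2 where "C2 = (1 + kc) * c0 / ((1 - D / t) * (1 - C * t / kc))"
  have pos: "0 < h x" "0 < u x" for x
    using assms by (simp_all add: u_def h_def)
  have "0 < C1" "0 < C2"
    unfolding C1_def C2_def using assms \<open>0 < s\<close> \<open>0 < t\<close>
    by (auto intro!: divide_pos_pos mult_pos_pos simp: s_def[symmetric] t_def[symmetric])
  have H1: "(\<integral>\<^sup>+y. H x y * ennreal (h y) \<partial>count_space UNIV) \<le> ennreal (C1 * h x)" for x
  proof -
    have "(\<integral>\<^sup>+y. H x y * ennreal (h y) \<partial>count_space UNIV)
        = (\<integral>\<^sup>+y. ennreal ((1 + kc) * (m x * ka powi \<l> x)) * (?G x y * ennreal (m y * s powi \<l> y)) \<partial>count_space UNIV)"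
      using assms by (intro nn_integral_cong)
        (simp add: H_def h_def s_def power_int_mult_distrib ennreal_mult mult_ac)
    also have "\<dots> = ennreal ((1 + kc) * (m x * ka powi \<l> x))
        * (\<integral>\<^sup>+y. ?G x y * ennreal (m y * s powi \<l> y) \<partial>count_space UNIV)"
      by (simp add: nn_integral_cmult)
    also have "\<dots> \<le> ennreal ((1 + kc) * (m x * ka powi \<l> x))
        * ennreal ((s / kc) powi \<l> x / ((1 - 1 / s) * (1 - s / kc)))"
      using assms by (intro mult_left_mono nn_integral_ancestor_kernel_mass_le) (auto simp: s_def)
    also have "\<dots> = ennreal ((1 + kc) * (m x * ka powi \<l> x) * ((s / kc) powi \<l> x / ((1 - 1 / s) * (1 - s / kc))))"
      using assms by (intro ennreal_mult[symmetric]) (auto simp: s_def)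
    also have "\<dots> \<le> ennreal (C1 * h x)"
    proof (rule ennreal_leI)
      have "ka powi \<l> x * (s / kc) powi \<l> x = (ka * kb / kc) powi \<l> x * q powi \<l> x"
        unfolding power_int_mult_distrib[symmetric] s_def by (simp add: mult_ac)
      then have "(1 + kc) * (m x * ka powi \<l> x) * ((s / kc) powi \<l> x / ((1 - 1 / s) * (1 - s / kc)))
          = m x * (ka * kb / kc) powi \<l> x * ((1 + kc) * q powi \<l> x / ((1 - 1 / s) * (1 - s / kc)))"
        by (simp add: mult_ac)
      also have "\<dots> \<le> c0 * ((1 + kc) * q powi \<l> x / ((1 - 1 / s) * (1 - s / kc)))"
        using assms \<open>0 < s\<close> by (intro mult_right_mono growth') (auto simp: s_def)
      also have "\<dots> = C1 * h x"
        by (simp add: C1_def h_def mult_ac)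
      finally show "(1 + kc) * (m x * ka powi \<l> x) * ((s / kc) powi \<l> x / ((1 - 1 / s) * (1 - s / kc)))
          \<le> C1 * h x" .
    qed
    finally show ?thesis .
  qed
  have h_powr: "h x powr (p - 1) = (q powr (p - 1)) powi \<l> x" for x
    using assms by (simp add: h_def powr_real_of_int'[symmetric] powr_powr mult.commute)
  have H2: "(\<integral>\<^sup>+x. H x y * ennreal (u x * h x powr (p - 1)) \<partial>count_space UNIV)
      \<le> ennreal (C2 * (u y * h y powr (p - 1)))" for y
  proof -
    have "(\<integral>\<^sup>+x. H x y * ennreal (u x * h x powr (p - 1)) \<partial>count_space UNIV)
        = (\<integral>\<^sup>+x. ennreal ((1 + kc) * (m y * kb powi \<l> y)) * (?G y x * ennreal (m x * m x * t powi \<l> x)) \<partial>count_space UNIV)"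
      using assms by (intro nn_integral_cong)
        (simp add: H_def h_powr u_def t_def power_int_mult_distrib ennreal_mult mult_ac
          ancestor_kernel_sym[of _ _ _ y])
    also have "\<dots> = ennreal ((1 + kc) * (m y * kb powi \<l> y))
        * (\<integral>\<^sup>+x. ?G y x * ennreal (m x * m x * t powi \<l> x) \<partial>count_space UNIV)"
      by (simp add: nn_integral_cmult)
    also have "\<dots> \<le> ennreal ((1 + kc) * (m y * kb powi \<l> y))
        * ennreal (m y * (t / kc) powi \<l> y / ((1 - D / t) * (1 - C * t / kc)))"
      using assms by (intro mult_left_mono nn_integral_ancestor_kernel_mass_sq_le) (auto simp: t_def)
    also have "\<dots> = ennreal ((1 + kc) * (m y * kb powi \<l> y) * (m y * (t / kc) powi \<l> y / ((1 - D / t) * (1 - C * t / kc))))"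
      using assms \<open>0 < t\<close> by (intro ennreal_mult[symmetric])
        (auto simp: t_def[symmetric] intro!: divide_nonneg_nonneg mult_nonneg_nonneg)
    also have "\<dots> \<le> ennreal (C2 * (u y * h y powr (p - 1)))"
    proof (rule ennreal_leI)
      have "kb powi \<l> y * (t / kc) powi \<l> y
          = (ka * kb / kc) powi \<l> y * (kd powi \<l> y * (q powr (p - 1)) powi \<l> y)"
        unfolding power_int_mult_distrib[symmetric] t_def by (simp add: mult_ac)
      then have "(1 + kc) * (m y * kb powi \<l> y) * (m y * (t / kc) powi \<l> y / ((1 - D / t) * (1 - C * t / kc)))
          = m y * (ka * kb / kc) powi \<l> y * ((1 + kc) * (m y * (kd powi \<l> y * (q powr (p - 1)) powi \<l> y))
              / ((1 - D / t) * (1 - C * t / kc)))"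
        by (simp add: mult_ac)
      also have "\<dots> \<le> c0 * ((1 + kc) * (m y * (kd powi \<l> y * (q powr (p - 1)) powi \<l> y))
              / ((1 - D / t) * (1 - C * t / kc)))"
        using assms \<open>0 < t\<close> by (intro mult_right_mono growth')
          (auto simp: t_def[symmetric] intro!: divide_nonneg_nonneg mult_nonneg_nonneg)
      also have "\<dots> = C2 * (u y * h y powr (p - 1))"
        by (simp add: C2_def h_powr u_def mult_ac)
      finally show "(1 + kc) * (m y * kb powi \<l> y) * (m y * (t / kc) powi \<l> y / ((1 - D / t) * (1 - C * t / kc)))
          \<le> C2 * (u y * h y powr (p - 1))" .
    qed
    finally show ?thesis .
  qed
  let ?M = "point_measure UNIV (\<lambda>x. ennreal (u x))"
  let ?sum = "\<lambda>f x. V_summand adj \<omega> m (\<lambda>n. kb powi n) (\<lambda>n. kc powi n) f x"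
  let ?V = "V_op adj \<omega> m (\<lambda>n. ka powi n) (\<lambda>n. kb powi n) (\<lambda>n. kc powi n)"
  let ?c = "C1 powr (p - 1) * C2"
  have u_nonneg: "0 \<le> u x" for x
    using pos(2)[of x] by simp
  have "(\<forall>x. (\<lambda>y. norm (?sum f x y)) summable_on UNIV) \<and> ?V f \<in> Lp_space p ?M
      \<and> Lp_norm p ?M (?V f) \<le> ?c powr (1 / p) * Lp_norm p ?M f" if f: "f \<in> Lp_space p ?M" for f
  proof -
    let ?F = "\<lambda>x. norm (f x)"
    let ?HF = "\<lambda>x. \<integral>\<^sup>+y. H x y * ennreal (?F y) \<partial>count_space UNIV"
    let ?N = "\<lambda>f. \<integral>\<^sup>+x. ennreal (u x * norm (f x) powr p) \<partial>count_space UNIV"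
    have fin: "?N f < \<infinity>"
      using f Lp_space_point_measure_iff[of u, OF u_nonneg] by blast
    note Schur = Schur_test[OF \<open>1 < p\<close> pos(1) pos(2) norm_ge_zero \<open>0 < C1\<close> less_imp_le[OF \<open>0 < C2\<close>] H1 H2 fin]
    have V_HF: "(\<lambda>y. norm (?sum f x y)) summable_on UNIV \<and> norm (?V f x) \<le> enn2real (?HF x)" for x
    proof -
      define a where "a = m x * ka powi \<l> x"
      have "0 < a"
        using assms by (simp add: a_def)
      have "ennreal a * ennreal (norm (?sum f x y)) \<le> H x y * ennreal (?F y)" for y
      proof -
        have "norm (?sum f x y)
            = \<bar>bergman_kernel adj \<omega> m (\<lambda>n. kc powi n) x y\<bar> * ?F y * (m y * kb powi \<l> y)"
          using assms by (simp only: V_summand_def norm_mult norm_of_real) (simp add: abs_mult)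
        then have "ennreal a * ennreal (norm (?sum f x y))
            = ennreal \<bar>bergman_kernel adj \<omega> m (\<lambda>n. kc powi n) x y\<bar>
              * (ennreal a * ennreal (m y * kb powi \<l> y) * ennreal (?F y))"
          using assms \<open>0 < a\<close> by (simp add: ennreal_mult mult_ac)
        also have "\<dots> \<le> ennreal (1 + kc) * ?G x y * (ennreal a * ennreal (m y * kb powi \<l> y) * ennreal (?F y))"
          using assms by (intro mult_right_mono abs_bergman_kernel_le) auto
        also have "\<dots> = H x y * ennreal (?F y)"
          using assms \<open>0 < a\<close> by (simp add: H_def a_def[symmetric] ennreal_mult mult_ac)
        finally show ?thesis .
      qed
      then have le: "ennreal a * (\<integral>\<^sup>+y. ennreal (norm (?sum f x y)) \<partial>count_space UNIV) \<le> ?HF x"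
        by (subst nn_integral_cmult[symmetric]) (auto intro: nn_integral_mono)
      also have "\<dots> < \<infinity>"
        by (rule Schur(1))
      finally have "(\<integral>\<^sup>+y. ennreal (norm (?sum f x y)) \<partial>count_space UNIV) < \<infinity>"
        using \<open>0 < a\<close> by (auto simp: ennreal_mult_less_top)
      note sum = summable_on_norm_nn_integral[OF this]
      have "ennreal (norm (?V f x)) = ennreal a * ennreal (norm (\<Sum>\<^sub>\<infinity>y. ?sum f x y))"
        using \<open>0 < a\<close> by (simp only: V_op_def norm_mult norm_of_real a_def[symmetric])
          (simp add: ennreal_mult)
      also have "\<dots> \<le> ennreal a * (\<integral>\<^sup>+y. ennreal (norm (?sum f x y)) \<partial>count_space UNIV)"
        by (intro mult_left_mono sum(2)) simp
      also note le
      finally have "ennreal (norm (?V f x)) \<le> ?HF x" .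
      then have "norm (?V f x) \<le> enn2real (?HF x)"
        using enn2real_mono[of "ennreal (norm (?V f x))" "?HF x"] Schur(1)[of x] by simp
      with sum(1) show ?thesis
        by blast
    qed
    have "?N (?V f) \<le> (\<integral>\<^sup>+x. ennreal (u x * enn2real (?HF x) powr p) \<partial>count_space UNIV)"
      using V_HF u_nonneg \<open>1 < p\<close>
      by (intro nn_integral_mono ennreal_leI mult_left_mono powr_mono2) auto
    also have "\<dots> \<le> ennreal ?c * ?N f"
      by (rule Schur(2))
    finally have N: "?N (?V f) \<le> ennreal ?c * ?N f" .
    have "ennreal ?c * ?N f < \<infinity>"
      using fin by (simp add: ennreal_mult_less_top)
    then have "?N (?V f) < \<infinity>"
      using N by (rule le_less_trans[rotated])
    moreover have "enn2real (?N (?V f)) \<le> ?c * enn2real (?N f)"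
      using enn2real_mono[OF N] \<open>ennreal ?c * ?N f < \<infinity>\<close> \<open>0 < C1\<close> \<open>0 < C2\<close> by (simp add: enn2real_mult)
    then have "enn2real (?N (?V f)) powr (1 / p) \<le> (?c * enn2real (?N f)) powr (1 / p)"
      using \<open>1 < p\<close> by (intro powr_mono2) auto
    then have "Lp_norm p ?M (?V f) \<le> ?c powr (1 / p) * Lp_norm p ?M f"
      unfolding Lp_norm_point_measure[of u, OF u_nonneg] using \<open>0 < C1\<close> \<open>0 < C2\<close> by (simp add: powr_mult)
    ultimately show ?thesis
      using V_HF Lp_space_point_measure_iff[of u, OF u_nonneg] by blast
  qed
  moreover have "weighted_measure adj \<omega> m (\<lambda>n. kd powi n) = ?M"
    by (simp add: weighted_measure_def u_def)
  ultimately show ?thesis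
    unfolding V_bounded_def Let_def by (intro exI[of _ "?c powr (1 / p)"]) simp
qed

end

section \<open>Choice of the weight\<close>

text \<open>Two intervals for \<open>ln q\<close> must have a common point. Each of them is nonempty since \<open>1 < kc\<close> and
  \<open>C D < kc\<close>; the latter holds since \<open>lower\<close> and \<open>upper\<close> together give \<open>(C D)\<^bsup>2+1/p\<^esup> < kc\<close>. That neither
  lies to the left of the other is what remains of \<open>lower\<close> and \<open>upper\<close> when a factor \<open>C D \<ge> 1\<close> is given
  away.\<close>

lemma ex_Schur_weight:
  fixes C D ka kb kc kd p p' :: real
  assumes pos: "0 < C" "0 < D" "0 < ka" "0 < kb" "0 < kd" and "1 < kc" "1 < p" "1 / p + 1 / p' = 1"
    and "1 \<le> C * D"
    and lower: "C * D powr (2 - 1 / p') * kb powr (1 / p') / (ka powr (1 / p) * kc powr (1 / p'))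
           < kd powr (1 / p)"
    and upper: "kd powr (1 / p)
           < kb powr (1 / p') * kc powr (1 / p) / (C powr (2 - 1 / p') * D * ka powr (1 / p))"
  obtains q where "0 < q" "1 < kb * q" "kb * q < kc"
    "D < ka * kd * q powr (p - 1)" "C * (ka * kd * q powr (p - 1)) < kc"
proof -
  define i where "i = 1 / p"
  have i: "0 < i" "i < 1" "1 / p' = 1 - i"
    using assms(7,8) by (simp_all add: i_def)
  have "0 < kc"
    using \<open>1 < kc\<close> by simp
  define a b c d \<delta> \<kappa> where "a = ln ka" and "b = ln kb" and "c = ln C" and "d = ln D"
    and "\<delta> = ln kd" and "\<kappa> = ln kc"
  note ln_defs = a_def b_def c_def d_def \<delta>_def \<kappa>_def
  have l1: "c + (1 + i) * d + (1 - i) * b - (i * a + (1 - i) * \<kappa>) < i * \<delta>"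
  proof -
    have "ln (C * D powr (2 - 1 / p') * kb powr (1 / p') / (ka powr (1 / p) * kc powr (1 / p')))
        < ln (kd powr (1 / p))"
      using lower pos \<open>0 < kc\<close> by (subst ln_less_cancel_iff) auto
    then show ?thesis
      using pos \<open>0 < kc\<close> unfolding i(3) i_def[symmetric] by (simp add: ln_mult ln_div ln_powr ln_defs)
  qed
  have l2: "i * \<delta> < (1 - i) * b + i * \<kappa> - ((1 + i) * c + d + i * a)"
  proof -
    have "ln (kd powr (1 / p))
        < ln (kb powr (1 / p') * kc powr (1 / p) / (C powr (2 - 1 / p') * D * ka powr (1 / p)))"
      using upper pos \<open>0 < kc\<close> by (subst ln_less_cancel_iff) auto
    then show ?thesis
      using pos \<open>0 < kc\<close> unfolding i(3) i_def[symmetric] by (simp add: ln_mult ln_div ln_powr ln_defs)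
  qed
  have "0 \<le> ln (C * D)"
    using assms(9) by simp
  then have cd: "0 \<le> c + d"
    using pos by (simp add: ln_mult ln_defs)
  have "0 < \<kappa>"
    using \<open>1 < kc\<close> by (simp add: ln_defs)
  have "c + d < \<kappa>"
  proof -
    have "(2 + i) * (c + d) < \<kappa>"
      using l1 l2 by (simp add: algebra_simps)
    moreover have "1 * (c + d) \<le> (2 + i) * (c + d)"
      using i cd by (intro mult_right_mono) auto
    ultimately show ?thesis
      by simp
  qed
  then have icd: "i * (c + d) < i * \<kappa>" "0 < (1 - i) * \<kappa>"
    using i \<open>0 < \<kappa>\<close> by simp_all
  \<comment> \<open>The unknown is scaled to \<open>X = (1 - 1/p) ln q = (1/p) (p - 1) ln q\<close>, in which both
    intervals have the coefficients of the hypotheses.\<close>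
  have "\<exists>X. max (- (1 - i) * b) (i * (d - a - \<delta>)) < X \<and> X < min ((1 - i) * (\<kappa> - b)) (i * (\<kappa> - c - a - \<delta>))"
    by (rule dense) (use l1 l2 icd cd in \<open>auto simp: algebra_simps\<close>)
  then obtain X where X: "- (1 - i) * b < X" "i * (d - a - \<delta>) < X" "X < (1 - i) * (\<kappa> - b)"
      "X < i * (\<kappa> - c - a - \<delta>)"
    by auto
  define x where "x = X / (1 - i)"
  have x: "- b < x" "x < \<kappa> - b" "(p - 1) * x = X / i"
    using X(1,3) i assms(7) by (simp_all add: x_def i_def field_simps)
  have y: "d - a - \<delta> < (p - 1) * x" "(p - 1) * x < \<kappa> - c - a - \<delta>"
    unfolding x(3) using X(2,4) i by (simp_all add: field_simps)
  let ?q = "exp x"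
  show thesis
  proof
    have "ln 1 < ln (kb * ?q)"
      using x pos by (simp add: ln_mult ln_defs)
    then show "1 < kb * ?q"
      using pos by (subst (asm) ln_less_cancel_iff) auto
    have "ln (kb * ?q) < ln kc"
      using x pos by (simp add: ln_mult ln_defs)
    then show "kb * ?q < kc"
      using pos \<open>0 < kc\<close> by (subst (asm) ln_less_cancel_iff) auto
    have "ln D < ln (ka * kd * ?q powr (p - 1))"
      using y pos by (simp add: ln_mult ln_powr ln_defs)
    then show "D < ka * kd * ?q powr (p - 1)"
      using pos by (subst (asm) ln_less_cancel_iff) auto
    have "ln (C * (ka * kd * ?q powr (p - 1))) < ln kc"
      using y pos by (simp add: ln_mult ln_powr ln_defs)
    then show "C * (ka * kd * ?q powr (p - 1)) < kc"
      using pos \<open>0 < kc\<close> by (subst (asm) ln_less_cancel_iff) auto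
  qed simp
qed

theorem proposition3p5:
  fixes adj :: "'v \<Rightarrow> 'v \<Rightarrow> bool" and v0 :: 'v and \<omega> :: "(nat \<Rightarrow> 'v) set"
    and m :: "'v \<Rightarrow> real"
    and ka kb kc kd p p' Cm Dm :: real
    and \<sigma>a \<sigma>b \<sigma>c \<sigma>d :: "int \<Rightarrow> real"
  assumes "infinite (UNIV :: 'v set)" and "tree adj" and "locally_finite adj"
    and "\<omega> \<in> boundary adj v0"
    and "\<And>x. card (succs adj \<omega> x) \<ge> 2"
    and "flow_measure adj \<omega> m"
    and "bdd_above (range (\<lambda>x. m (pred adj \<omega> x) / m x))"
    and Cm: "Cm = (SUP x. m (pred adj \<omega> x) / m x)"
    and Dm: "Dm = (SUP x. m x / m (pred adj \<omega> x))"
    and "ka > 0" and "kb > 0" and "kd > 0" and "kc > 1"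
    and "\<sigma>a = (\<lambda>n. ka powi n)" and "\<sigma>b = (\<lambda>n. kb powi n)"
    and "\<sigma>c = (\<lambda>n. kc powi n)" and "\<sigma>d = (\<lambda>n. kd powi n)"
    and "1 < p" and "1 / p + 1 / p' = 1"
    and "\<exists>c0>0. \<forall>x. m x \<le> c0 * (kc / (kb * ka)) powi level adj \<omega> x"
    and "Cm * Dm powr (2 - 1 / p') * kb powr (1 / p') / (ka powr (1 / p) * kc powr (1 / p'))
           < kd powr (1 / p)"
    and "kd powr (1 / p)
           < kb powr (1 / p') * kc powr (1 / p) / (Cm powr (2 - 1 / p') * Dm * ka powr (1 / p))"
  shows "V_bounded adj \<omega> m \<sigma>a \<sigma>b \<sigma>c p \<sigma>d"
proof -
  interpret rooted_flow adj v0 \<omega> m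
    by standard (fact assms)+
  have C: "m (\<pp> x) \<le> Cm * m x" for x
  proof -
    have "m (\<pp> x) / m x \<le> Cm"
      unfolding Cm by (rule cSUP_upper) (use assms(7) in auto)
    then show ?thesis
      by (simp add: field_simps)
  qed
  have D: "m x \<le> Dm * m (\<pp> x)" for x
  proof -
    have "bdd_above (range (\<lambda>x. m x / m (\<pp> x)))"
      by (rule bdd_aboveI[of _ 1]) (auto simp: m_le_m_pred)
    then have "m x / m (\<pp> x) \<le> Dm"
      unfolding Dm by (intro cSUP_upper) auto
    then show ?thesis
      by (simp add: field_simps)
  qed
  have pos: "0 < Cm" "0 < Dm"
    using C[of v0] D[of v0] m_pos[of v0] m_pos[of "\<pp> v0"] by (meson le_less_trans less_le_trans zero_less_mult_pos2)+
  \<comment> \<open>Going up one edge and back restores the mass, which is multiplied by at most \<open>Cm * Dm\<close>.\<close>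
  have "1 * m v0 \<le> Cm * Dm * m v0"
  proof -
    have "m v0 \<le> Dm * m (\<pp> v0)"
      by (rule D)
    also have "\<dots> \<le> Dm * (Cm * m v0)"
      using pos by (intro mult_left_mono C) auto
    finally show ?thesis
      by (simp add: mult_ac)
  qed
  then have CD: "1 \<le> Cm * Dm"
    by (rule mult_right_le_imp_le) simp
  obtain c0 where c0: "0 < c0" "\<And>x. m x \<le> c0 * (kc / (kb * ka)) powi \<l> x"
    using assms(20) by blast
  obtain q where q: "0 < q" "1 < kb * q" "kb * q < kc"
    "Dm < ka * kd * q powr (p - 1)" "Cm * (ka * kd * q powr (p - 1)) < kc"
    using ex_Schur_weight[OF pos \<open>0 < ka\<close> \<open>0 < kb\<close> \<open>0 < kd\<close> \<open>1 < kc\<close> \<open>1 < p\<close> \<open>1 / p + 1 / p' = 1\<close> CD assms(21,22)]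
    by blast
  show ?thesis
    unfolding \<open>\<sigma>a = _\<close> \<open>\<sigma>b = _\<close> \<open>\<sigma>c = _\<close> \<open>\<sigma>d = _\<close>
    by (rule V_bounded_if_Schur_weight[OF \<open>0 < ka\<close> \<open>0 < kb\<close> \<open>0 < kd\<close> \<open>1 < kc\<close> \<open>1 < p\<close> q(1)
          pos(1) C pos(2) D c0 q(2-5)])
qed

end
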